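(* Let $\mathcal{C}$ be a category with pullbacks and let $p:\mathcal{E}\to\mathcal{C}$ be a (cloven) bifibration satisfying the Beck--Chevalley condition. Then for every morphism $f:B\to A$ in $\mathcal{C}$ there are equivalences of categories $$\mathsf{EM}_p(T_f)\;\simeq\;\mathsf{Desc}_p(f)\;\simeq\;\mathsf{Act}_p^{\mathsf{Eq}(f)},$$ where $\mathsf{EM}_p(T_f)$ is the Eilenberg--Moore category of the monad $T_f=f^{*}f_{!}$ on the fiber $\mathcal{E}_B$, $\mathsf{Desc}_p(f)$ is the category of descent data for $f$ with respect to $p$, and $\mathsf{Act}_p^{\mathsf{Eq}(f)}$ is the category of actions on $p$ of the internal category $\mathsf{Eq}(f)$ induced by the kernel pair of $f$.
   Context: Conventions: composition of functors is juxtaposition; $\circ$ is vertical composition of natural transformations and composition of morphisms in a category; $\cdot$ is horizontal composition (including whiskering). Bifibration data. A bifibration is a functor $p:\mathcal{E}\to\mathcal{C}$ that is both a Grothendieck fibration and an opfibration; it is cloven, i.e. comes with chosen cartesian lifts $\hat f_X:f^{*}X\to X$ (for $f:B\to A$ in $\mathcal{C}$, $X\in\mathcal{E}_A$) and chosen cocartesian lifts $\tilde f_Y:Y\to f_!Y$ (for $Y\in\mathcal{E}_B$). Here $\mathcal{E}_A$ denotes the fiber of $p$ over $A$. These induce functors $f^{*}:\mathcal{E}_A\to\mathcal{E}_B$ and $f_!:\mathcal{E}_B\to\mathcal{E}_A$, with $f_!$ left adjoint to $f^{*}$. The unit $\eta_f:\mathrm{Id}_{\mathcal{E}_B}\Rightarrow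 f^{*}f_!$ and counit $\varepsilon_f:f_!f^{*}\Rightarrow\mathrm{Id}_{\mathcal{E}_A}$ are given by the unique morphisms in the fibers with $\hat f_{f_!X}\circ\eta_{f,X}=\tilde f_X$ and $\varepsilon_{f,Y}\circ\tilde f_{f^{*}Y}=\hat f_Y$. The pseudofunctoriality isomorphisms $\iota_B:\mathrm{Id}_{\mathcal{E}_B}\Rightarrow(\mathrm{id}_B)^{*}$ and $\kappa_{f,g}:g^{*}f^{*}\Rightarrow(f\circ g)^{*}$ (for $g:C\to B$, $f:B\to A$) have as components the unique morphisms in the fibers with $(\widehat{\mathrm{id}_B})_X\circ\iota_{B,X}=\mathrm{id}_X$ and $(\widehat{f\circ g})_Y\circ\kappa_{f,g,Y}=\hat f_Y\circ\hat g_{f^{*}Y}$. Beck--Chevalley condition. For a pullback square $P$ in $\mathcal{C}$ with $d\circ a=b\circ c$, where $c$ and $a$ are the projections out of the pullback of $b$ and $d$, the Beck--Chevalley transformation $\mathsf{BC}_P:c_!a^{*}\Rightarrow b^{*}d_!$ is $$\mathsf{BC}_P:=(\varepsilon_c\cdot b^{*}d_!)\circ\bigl(c_!\cdot(\kappa_{b,c}^{-1}\circ\kappa_{d,a})\cdot d_!\bigr)\circ(c_!a^{*}\cdot\eta_d).$$ The bifibration $p$ satisfies the Beck--Chevalley condition if $\mathsf{BC}_P$ is an isomorphism for every pullback square $P$ in $\mathcal{C}$; its inverse is denoted $\overline{\mathsf{BC}}_P:b^{*}d_!\Rightarrow c_!a^{*}$. Setting for a morphism $f:B\to A$ of $\mathcal{C}$.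 Let $f_1,f_2:B\times_AB\to B$ be the kernel pair of $f$ (so $f\circ f_1=f\circ f_2$). Let $\pi_1,\pi_2:(B\times_AB)\times_B(B\times_AB)\to B\times_AB$ be the projections of the pullback square $P_2$ given by $f_2\circ\pi_2=f_1\circ\pi_1$. Let $\pi=\langle f_1\pi_2,f_2\pi_1\rangle:(B\times_AB)\times_B(B\times_AB)\to B\times_AB$ be the unique morphism with $f_1\pi=f_1\pi_2$ and $f_2\pi=f_2\pi_1$, and let $\Delta=\langle\mathrm{id}_B,\mathrm{id}_B\rangle:B\to B\times_AB$ be the diagonal. ($\mathsf{Eq}(f)$ is the internal category in $\mathcal{C}$ with object of objects $B$, object of morphisms $B\times_AB$, source $f_1$, target $f_2$, identities $\Delta$ and composition $\pi$.) For $i=1,2$ put $$d_i:=\kappa_{f_i,\Delta}^{-1}\circ\iota_B:\mathrm{Id}_{\mathcal{E}_B}\Rightarrow\Delta^{*}f_i^{*},\qquad j_i:=\kappa_{f_i,\pi_{3-i}}^{-1}\circ\kappa_{f_i,\pi}:\pi^{*}f_i^{*}\Rightarrow\pi_{3-i}^{*}f_i^{*},$$ $$j:=\kappa_{f_1,\pi_1}^{-1}\circ\kappa_{f_2,\pi_2}:\pi_2^{*}f_2^{*}\Rightarrow\pi_1^{*}f_1^{*}.$$ The category $\mathsf{EM}_p(T_f)$. Let $T_f=(f^{*}f_!,\eta_f,\mu)$ with $\mu=f^{*}\cdot\varepsilon_f\cdot f_!$ be the monad on $\mathcal{E}_B$ induced by the adjunction between $f_!$ and $f^{*}$. Objects of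 $\mathsf{EM}_p(T_f)$ are pairs $(X,\alpha)$ with $X\in\mathcal{E}_B$ and $\alpha:T_f(X)\to X$ in $\mathcal{E}_B$ such that $\alpha\circ(\eta_f)_X=\mathrm{id}_X$ and $\alpha\circ\mu_X=\alpha\circ T_f(\alpha)$. Morphisms $(X,\alpha)\to(Y,\alpha')$ are morphisms $\phi:X\to Y$ in $\mathcal{E}_B$ with $\phi\circ\alpha=\alpha'\circ T_f(\phi)$. The category $\mathsf{Desc}_p(f)$. Objects are pairs $(X,\varphi)$ with $X\in\mathcal{E}_B$ and $\varphi:f_1^{*}X\to f_2^{*}X$ an isomorphism in $\mathcal{E}_{B\times_AB}$ such that $$(d_2^{-1})_X\circ\Delta^{*}\varphi\circ(d_1)_X=\mathrm{id}_X,\qquad \pi_1^{*}\varphi\circ j_X\circ\pi_2^{*}\varphi=(j_2)_X\circ\pi^{*}\varphi\circ(j_1^{-1})_X.$$ Morphisms $(X,\varphi)\to(Y,\psi)$ are morphisms $\theta:X\to Y$ in $\mathcal{E}_B$ with $f_2^{*}\theta\circ\varphi=\psi\circ f_1^{*}\theta$. The category $\mathsf{Act}_p^{\mathsf{Eq}(f)}$. For a natural transformation $\alpha:g^{*}f^{*}\Rightarrow k^{*}h^{*}$ (here $f,g,h,k$ are arbitrary morphisms of $\mathcal{C}$ for which this makes sense), its mate is $$\mathrm{mate}(\alpha):=(\varepsilon_k\cdot h^{*}f_!)\circ(k_!\cdot\alpha\cdot f_!)\circ(k_!g^{*}\cdot\eta_f):k_!g^{*}\Rightarrow h^{*}f_!,$$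 and its two-fold mate is $$(\varepsilon_h\cdot f_!g_!)\circ(h_!\cdot\mathrm{mate}(\alpha)\cdot g_!)\circ(h_!k_!\cdot\eta_g):h_!k_!\Rightarrow f_!g_!.$$ Let $k_i:(f_i)_!(\pi_{3-i})_!\Rightarrow(f_i)_!\pi_!$ be the two-fold mate of $j_i$. Define $\eta':\mathrm{Id}_{\mathcal{E}_B}\Rightarrow(f_2)_!f_1^{*}$ and $\mu':(f_2)_!f_1^{*}(f_2)_!f_1^{*}\Rightarrow(f_2)_!f_1^{*}$ by $$\eta':=(d_2^{-1}\cdot(f_2)_!f_1^{*})\circ(\Delta^{*}\cdot\eta_{f_2}\cdot f_1^{*})\circ d_1,$$ $$\mu':=((f_2)_!\cdot\varepsilon_\pi\cdot f_1^{*})\circ(k_2\cdot j_1^{-1})\circ((f_2)_!\cdot\overline{\mathsf{BC}}_{P_2}\cdot f_1^{*}),$$ where $\overline{\mathsf{BC}}_{P_2}:f_1^{*}(f_2)_!\Rightarrow(\pi_1)_!\pi_2^{*}$ is the inverse of the Beck--Chevalley transformation $\mathsf{BC}_{P_2}:(\pi_1)_!\pi_2^{*}\Rightarrow f_1^{*}(f_2)_!$ of $P_2$ (that is, $a=\pi_2$, $c=\pi_1$, $b=f_1$, $d=f_2$). Objects of $\mathsf{Act}_p^{\mathsf{Eq}(f)}$ are pairs $(X,\beta)$ with $X\in\mathcal{E}_B$ and $\beta:(f_2)_!f_1^{*}X\to X$ in $\mathcal{E}_B$ such that $\beta\circ\eta'_X=\mathrm{id}_X$ and $\beta\circ\mu'_X=\beta\circ(f_2)_!f_1^{*}\beta$.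 Morphisms $(X,\beta)\to(X',\beta')$ are morphisms $h:X\to X'$ in $\mathcal{E}_B$ with $h\circ\beta=\beta'\circ(f_2)_!f_1^{*}h$. *)

theory Defs
  imports Main
begin

section \<open>Categories, functors, natural transformations\<close>

text \<open>
  Categories are partial structures on the carriers \<open>Ob\<close> and \<open>Mor\<close>; all functions are
  unspecified outside the carriers. \<open>g \<bullet>\<^bsub>C\<^esub> f\<close> is \<open>g\<close> after \<open>f\<close>.
\<close>

record ('o, 'm) cat =
  Ob :: "'o set"
  Mor :: "'m set"
  Dom :: "'m \<Rightarrow> 'o"
  Cod :: "'m \<Rightarrow> 'o"
  Idm :: "'o \<Rightarrow> 'm"
  Comp :: "'m \<Rightarrow> 'm \<Rightarrow> 'm"  (infixr "\<bullet>\<index>" 70)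

definition Hom :: "('o, 'm) cat \<Rightarrow> 'o \<Rightarrow> 'o \<Rightarrow> 'm set" where
  "Hom C X Y = {f \<in> Mor C. Dom C f = X \<and> Cod C f = Y}"

locale category =
  fixes C :: "('o, 'm) cat" (structure)
  assumes dom_ob: "f \<in> Mor C \<Longrightarrow> Dom C f \<in> Ob C"
    and cod_ob: "f \<in> Mor C \<Longrightarrow> Cod C f \<in> Ob C"
    and id_hom: "X \<in> Ob C \<Longrightarrow> Idm C X \<in> Hom C X X"
    and comp_hom: "\<lbrakk>f \<in> Hom C X Y; g \<in> Hom C Y Z\<rbrakk> \<Longrightarrow> g \<bullet> f \<in> Hom C X Z"
    and comp_id_right: "f \<in> Hom C X Y \<Longrightarrow> f \<bullet> Idm C X = f"
    and comp_id_left: "f \<in> Hom C X Y \<Longrightarrow> Idm C Y \<bullet> f = f"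
    and comp_assoc: "\<lbrakk>f \<in> Hom C X Y; g \<in> Hom C Y Z; h \<in> Hom C Z W\<rbrakk>
      \<Longrightarrow> (h \<bullet> g) \<bullet> f = h \<bullet> (g \<bullet> f)"

definition is_inverse :: "('o, 'm) cat \<Rightarrow> 'm \<Rightarrow> 'm \<Rightarrow> bool" where
  "is_inverse C f g \<longleftrightarrow> f \<in> Mor C \<and> g \<in> Hom C (Cod C f) (Dom C f)
     \<and> g \<bullet>\<^bsub>C\<^esub> f = Idm C (Dom C f) \<and> f \<bullet>\<^bsub>C\<^esub> g = Idm C (Cod C f)"

definition is_iso :: "('o, 'm) cat \<Rightarrow> 'm \<Rightarrow> bool" where
  "is_iso C f \<longleftrightarrow> (\<exists>g. is_inverse C f g)"

definition inverse_of :: "('o, 'm) cat \<Rightarrow> 'm \<Rightarrow> 'm" where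
  "inverse_of C f = (THE g. is_inverse C f g)"

record ('o, 'm, 'o2, 'm2) funct =
  on_ob :: "'o \<Rightarrow> 'o2"
  on_mor :: "'m \<Rightarrow> 'm2"

locale is_functor = C: category C + D: category D
  for C :: "('o, 'm) cat" and D :: "('o2, 'm2) cat" +
  fixes F :: "('o, 'm, 'o2, 'm2) funct"
  assumes ob: "X \<in> Ob C \<Longrightarrow> on_ob F X \<in> Ob D"
    and hom: "f \<in> Hom C X Y \<Longrightarrow> on_mor F f \<in> Hom D (on_ob F X) (on_ob F Y)"
    and map_id: "X \<in> Ob C \<Longrightarrow> on_mor F (Idm C X) = Idm D (on_ob F X)"
    and map_comp: "\<lbrakk>f \<in> Hom C X Y; g \<in> Hom C Y Z\<rbrakk>
      \<Longrightarrow> on_mor F (g \<bullet>\<^bsub>C\<^esub> f) = on_mor F g \<bullet>\<^bsub>D\<^esub> on_mor F f"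

definition id_funct :: "('o, 'm, 'o, 'm) funct" where
  "id_funct = \<lparr>on_ob = (\<lambda>X. X), on_mor = (\<lambda>f. f)\<rparr>"

definition comp_funct ::
    "('o2, 'm2, 'o3, 'm3) funct \<Rightarrow> ('o, 'm, 'o2, 'm2) funct \<Rightarrow> ('o, 'm, 'o3, 'm3) funct"
    (infixr "\<circ>\<^sub>F" 75) where
  "G \<circ>\<^sub>F F = \<lparr>on_ob = (\<lambda>X. on_ob G (on_ob F X)), on_mor = (\<lambda>f. on_mor G (on_mor F f))\<rparr>"

locale natural_transformation = F: is_functor C D F + G: is_functor C D G
  for C :: "('o, 'm) cat" and D :: "('o2, 'm2) cat"
    and F :: "('o, 'm, 'o2, 'm2) funct" and G :: "('o, 'm, 'o2, 'm2) funct" +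
  fixes \<alpha> :: "'o \<Rightarrow> 'm2"
  assumes component: "X \<in> Ob C \<Longrightarrow> \<alpha> X \<in> Hom D (on_ob F X) (on_ob G X)"
    and naturality: "f \<in> Hom C X Y
      \<Longrightarrow> on_mor G f \<bullet>\<^bsub>D\<^esub> \<alpha> X = \<alpha> Y \<bullet>\<^bsub>D\<^esub> on_mor F f"

locale natural_isomorphism = natural_transformation +
  assumes component_iso: "X \<in> Ob C \<Longrightarrow> is_iso D (\<alpha> X)"

definition equivalent_categories :: "('o, 'm) cat \<Rightarrow> ('o2, 'm2) cat \<Rightarrow> bool" where
  "equivalent_categories C D \<longleftrightarrow> (\<exists>F G \<alpha> \<beta>. is_functor C D F \<and> is_functor D C G
     \<and> natural_isomorphism C C id_funct (G \<circ>\<^sub>F F) \<alpha>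
     \<and> natural_isomorphism D D (F \<circ>\<^sub>F G) id_funct \<beta>)"

text \<open>Whiskering; a natural transformation is represented by its family of components.\<close>

definition whisker_left :: "('o2, 'm2, 'o3, 'm3) funct \<Rightarrow> ('o \<Rightarrow> 'm2) \<Rightarrow> 'o \<Rightarrow> 'm3"
    (infixr "\<rhd>" 72) where
  "F \<rhd> \<alpha> = (\<lambda>X. on_mor F (\<alpha> X))"

definition whisker_right :: "('o2 \<Rightarrow> 'm3) \<Rightarrow> ('o, 'm, 'o2, 'm2) funct \<Rightarrow> 'o \<Rightarrow> 'm3"
    (infixl "\<lhd>" 73) where
  "\<alpha> \<lhd> F = (\<lambda>X. \<alpha> (on_ob F X))"


section \<open>Pullbacks\<close>

text \<open>
  \<open>pullback_square C a c b d\<close>: the square \<open>d \<bullet> a = b \<bullet> c\<close> is a pullback of \<open>b\<close> and \<open>d\<close>.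
\<close>

definition pullback_square :: "('o, 'm) cat \<Rightarrow> 'm \<Rightarrow> 'm \<Rightarrow> 'm \<Rightarrow> 'm \<Rightarrow> bool" where
  "pullback_square C a c b d \<longleftrightarrow>
     a \<in> Hom C (Dom C a) (Dom C d) \<and> c \<in> Hom C (Dom C a) (Dom C b) \<and>
     b \<in> Mor C \<and> d \<in> Hom C (Dom C d) (Cod C b) \<and>
     d \<bullet>\<^bsub>C\<^esub> a = b \<bullet>\<^bsub>C\<^esub> c \<and>
     (\<forall>Z u v. u \<in> Hom C Z (Dom C d) \<longrightarrow> v \<in> Hom C Z (Dom C b) \<longrightarrow>
        d \<bullet>\<^bsub>C\<^esub> u = b \<bullet>\<^bsub>C\<^esub> v \<longrightarrow>
        (\<exists>!h. h \<in> Hom C Z (Dom C a) \<and> a \<bullet>\<^bsub>C\<^esub> h = u \<and> c \<bullet>\<^bsub>C\<^esub> h = v))"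

definition has_pullbacks :: "('o, 'm) cat \<Rightarrow> bool" where
  "has_pullbacks C \<longleftrightarrow> (\<forall>b \<in> Mor C. \<forall>d \<in> Mor C. Cod C b = Cod C d \<longrightarrow>
     (\<exists>a c. pullback_square C a c b d))"


section \<open>Cloven bifibrations\<close>

text \<open>
  \<open>cart p f X\<close> is the chosen cartesian lift \<open>f\<^sup>*X \<rightarrow> X\<close> and \<open>cocart p f Y\<close> the chosen cocartesian
  lift \<open>Y \<rightarrow> f\<^sub>!Y\<close>.
\<close>

record ('co, 'cm, 'eo, 'em) bifib =
  base :: "('co, 'cm) cat"
  total_cat :: "('eo, 'em) cat"
  proj :: "('eo, 'em, 'co, 'cm) funct"
  cart :: "'cm \<Rightarrow> 'eo \<Rightarrow> 'em"
  cocart :: "'cm \<Rightarrow> 'eo \<Rightarrow> 'em"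

definition fiber :: "('co, 'cm, 'eo, 'em) bifib \<Rightarrow> 'co \<Rightarrow> ('eo, 'em) cat" where
  "fiber p A = (total_cat p)
     \<lparr>Ob := {X \<in> Ob (total_cat p). on_ob (proj p) X = A},
      Mor := {e \<in> Mor (total_cat p). on_mor (proj p) e = Idm (base p) A \<and>
                on_ob (proj p) (Dom (total_cat p) e) = A \<and> on_ob (proj p) (Cod (total_cat p) e) = A}\<rparr>"

definition is_cartesian :: "('co, 'cm, 'eo, 'em) bifib \<Rightarrow> 'em \<Rightarrow> bool" where
  "is_cartesian p e \<longleftrightarrow> e \<in> Mor (total_cat p) \<and>
     (\<forall>Z e' u. e' \<in> Hom (total_cat p) Z (Cod (total_cat p) e) \<longrightarrow>
        u \<in> Hom (base p) (on_ob (proj p) Z) (on_ob (proj p) (Dom (total_cat p) e)) \<longrightarrow>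
        on_mor (proj p) e \<bullet>\<^bsub>base p\<^esub> u = on_mor (proj p) e' \<longrightarrow>
        (\<exists>!v. v \<in> Hom (total_cat p) Z (Dom (total_cat p) e) \<and> on_mor (proj p) v = u \<and>
              e \<bullet>\<^bsub>total_cat p\<^esub> v = e'))"

definition is_cocartesian :: "('co, 'cm, 'eo, 'em) bifib \<Rightarrow> 'em \<Rightarrow> bool" where
  "is_cocartesian p e \<longleftrightarrow> e \<in> Mor (total_cat p) \<and>
     (\<forall>Z e' u. e' \<in> Hom (total_cat p) (Dom (total_cat p) e) Z \<longrightarrow>
        u \<in> Hom (base p) (on_ob (proj p) (Cod (total_cat p) e)) (on_ob (proj p) Z) \<longrightarrow>
        u \<bullet>\<^bsub>base p\<^esub> on_mor (proj p) e = on_mor (proj p) e' \<longrightarrow>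
        (\<exists>!v. v \<in> Hom (total_cat p) (Cod (total_cat p) e) Z \<and> on_mor (proj p) v = u \<and>
              v \<bullet>\<^bsub>total_cat p\<^esub> e = e'))"

locale cloven_bifibration =
  fixes p :: "('co, 'cm, 'eo, 'em) bifib"
  assumes proj_functor: "is_functor (total_cat p) (base p) (proj p)"
    and cart_lift: "\<lbrakk>f \<in> Hom (base p) B A; X \<in> Ob (fiber p A)\<rbrakk> \<Longrightarrow>
      is_cartesian p (cart p f X) \<and> Cod (total_cat p) (cart p f X) = X
      \<and> on_mor (proj p) (cart p f X) = f"
    and cocart_lift: "\<lbrakk>f \<in> Hom (base p) B A; Y \<in> Ob (fiber p B)\<rbrakk> \<Longrightarrow>
      is_cocartesian p (cocart p f Y) \<and> Dom (total_cat p) (cocart p f Y) = Y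
      \<and> on_mor (proj p) (cocart p f Y) = f"

definition pull :: "('co, 'cm, 'eo, 'em) bifib \<Rightarrow> 'cm \<Rightarrow> ('eo, 'em, 'eo, 'em) funct" where
  "pull p f = \<lparr>on_ob = (\<lambda>X. Dom (total_cat p) (cart p f X)),
     on_mor = (\<lambda>\<theta>. let X = Dom (total_cat p) \<theta>; Y = Cod (total_cat p) \<theta> in
       THE \<theta>'. \<theta>' \<in> Hom (fiber p (Dom (base p) f))
                  (Dom (total_cat p) (cart p f X)) (Dom (total_cat p) (cart p f Y))
              \<and> cart p f Y \<bullet>\<^bsub>total_cat p\<^esub> \<theta>' = \<theta> \<bullet>\<^bsub>total_cat p\<^esub> cart p f X)\<rparr>"

definition push :: "('co, 'cm, 'eo, 'em) bifib \<Rightarrow> 'cm \<Rightarrow> ('eo, 'em, 'eo, 'em) funct" where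
  "push p f = \<lparr>on_ob = (\<lambda>Y. Cod (total_cat p) (cocart p f Y)),
     on_mor = (\<lambda>\<theta>. let X = Dom (total_cat p) \<theta>; Y = Cod (total_cat p) \<theta> in
       THE \<theta>'. \<theta>' \<in> Hom (fiber p (Cod (base p) f))
                  (Cod (total_cat p) (cocart p f X)) (Cod (total_cat p) (cocart p f Y))
              \<and> \<theta>' \<bullet>\<^bsub>total_cat p\<^esub> cocart p f X = cocart p f Y \<bullet>\<^bsub>total_cat p\<^esub> \<theta>)\<rparr>"

definition unit :: "('co, 'cm, 'eo, 'em) bifib \<Rightarrow> 'cm \<Rightarrow> 'eo \<Rightarrow> 'em" where
  "unit p f X = (THE e.
     e \<in> Hom (fiber p (Dom (base p) f)) X (on_ob (pull p f \<circ>\<^sub>F push p f) X)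
     \<and> cart p f (on_ob (push p f) X) \<bullet>\<^bsub>total_cat p\<^esub> e = cocart p f X)"

definition counit :: "('co, 'cm, 'eo, 'em) bifib \<Rightarrow> 'cm \<Rightarrow> 'eo \<Rightarrow> 'em" where
  "counit p f Y = (THE e.
     e \<in> Hom (fiber p (Cod (base p) f)) (on_ob (push p f \<circ>\<^sub>F pull p f) Y) Y
     \<and> e \<bullet>\<^bsub>total_cat p\<^esub> cocart p f (on_ob (pull p f) Y) = cart p f Y)"

definition iota :: "('co, 'cm, 'eo, 'em) bifib \<Rightarrow> 'co \<Rightarrow> 'eo \<Rightarrow> 'em" where
  "iota p B X = (THE e.
     e \<in> Hom (fiber p B) X (on_ob (pull p (Idm (base p) B)) X)
     \<and> cart p (Idm (base p) B) X \<bullet>\<^bsub>total_cat p\<^esub> e = Idm (total_cat p) X)"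

definition kappa :: "('co, 'cm, 'eo, 'em) bifib \<Rightarrow> 'cm \<Rightarrow> 'cm \<Rightarrow> 'eo \<Rightarrow> 'em" where
  "kappa p f g Y = (THE e.
     e \<in> Hom (fiber p (Dom (base p) g))
           (on_ob (pull p g \<circ>\<^sub>F pull p f) Y) (on_ob (pull p (f \<bullet>\<^bsub>base p\<^esub> g)) Y)
     \<and> cart p (f \<bullet>\<^bsub>base p\<^esub> g) Y \<bullet>\<^bsub>total_cat p\<^esub> e
         = cart p f Y \<bullet>\<^bsub>total_cat p\<^esub> cart p g (on_ob (pull p f) Y))"

text \<open>
  Vertical composition, horizontal composition and inverses of transformations between functors of
  fibers. Composition in a fiber is composition in the total category, and the inverse of a vertical
  isomorphism is vertical. For \<open>\<alpha> : F \<Rightarrow> F'\<close> and \<open>\<beta> : G \<Rightarrow> G'\<close> the horizontal composite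
  \<open>\<alpha> \<cdot> \<beta> : F G \<Rightarrow> F' G'\<close> is \<open>hcomp p F \<alpha> \<beta> G'\<close>.
\<close>

definition vcomp ::
    "('co, 'cm, 'eo, 'em) bifib \<Rightarrow> ('eo \<Rightarrow> 'em) \<Rightarrow> ('eo \<Rightarrow> 'em) \<Rightarrow> 'eo \<Rightarrow> 'em"
    ("(_ \<odot>\<index>/ _)" [66, 65] 65) where
  "\<alpha> \<odot>\<^bsub>p\<^esub> \<beta> = (\<lambda>X. \<alpha> X \<bullet>\<^bsub>total_cat p\<^esub> \<beta> X)"

definition hcomp ::
    "('co, 'cm, 'eo, 'em) bifib \<Rightarrow> ('eo, 'em, 'eo, 'em) funct \<Rightarrow> ('eo \<Rightarrow> 'em) \<Rightarrow> ('eo \<Rightarrow> 'em)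
      \<Rightarrow> ('eo, 'em, 'eo, 'em) funct \<Rightarrow> 'eo \<Rightarrow> 'em" where
  "hcomp p F \<alpha> \<beta> G' = (\<alpha> \<lhd> G') \<odot>\<^bsub>p\<^esub> (F \<rhd> \<beta>)"

definition inv_trans ::
    "('co, 'cm, 'eo, 'em) bifib \<Rightarrow> ('eo \<Rightarrow> 'em) \<Rightarrow> 'eo \<Rightarrow> 'em" where
  "inv_trans p \<alpha> = (\<lambda>X. inverse_of (total_cat p) (\<alpha> X))"


section \<open>The Beck--Chevalley condition\<close>

definition BC :: "('co, 'cm, 'eo, 'em) bifib \<Rightarrow> 'cm \<Rightarrow> 'cm \<Rightarrow> 'cm \<Rightarrow> 'cm \<Rightarrow> 'eo \<Rightarrow> 'em" where
  "BC p a c b d =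
     (counit p c \<lhd> (pull p b \<circ>\<^sub>F push p d))
     \<odot>\<^bsub>p\<^esub> (push p c \<rhd> ((inv_trans p (kappa p b c) \<odot>\<^bsub>p\<^esub> kappa p d a) \<lhd> push p d))
     \<odot>\<^bsub>p\<^esub> ((push p c \<circ>\<^sub>F pull p a) \<rhd> unit p d)"

definition beck_chevalley :: "('co, 'cm, 'eo, 'em) bifib \<Rightarrow> bool" where
  "beck_chevalley p \<longleftrightarrow> (\<forall>a c b d. pullback_square (base p) a c b d \<longrightarrow>
     natural_isomorphism (fiber p (Dom (base p) d)) (fiber p (Dom (base p) b))
       (push p c \<circ>\<^sub>F pull p a) (pull p b \<circ>\<^sub>F push p d) (BC p a c b d))"

text \<open>Mates of \<open>\<alpha> : g\<^sup>*f\<^sup>* \<Rightarrow> k\<^sup>*h\<^sup>*\<close>.\<close>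

definition mate ::
    "('co, 'cm, 'eo, 'em) bifib \<Rightarrow> 'cm \<Rightarrow> 'cm \<Rightarrow> 'cm \<Rightarrow> 'cm \<Rightarrow> ('eo \<Rightarrow> 'em) \<Rightarrow> 'eo \<Rightarrow> 'em" where
  "mate p g f k h \<alpha> =
     (counit p k \<lhd> (pull p h \<circ>\<^sub>F push p f))
     \<odot>\<^bsub>p\<^esub> (push p k \<rhd> (\<alpha> \<lhd> push p f))
     \<odot>\<^bsub>p\<^esub> ((push p k \<circ>\<^sub>F pull p g) \<rhd> unit p f)"

definition twofold_mate ::
    "('co, 'cm, 'eo, 'em) bifib \<Rightarrow> 'cm \<Rightarrow> 'cm \<Rightarrow> 'cm \<Rightarrow> 'cm \<Rightarrow> ('eo \<Rightarrow> 'em) \<Rightarrow> 'eo \<Rightarrow> 'em" where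
  "twofold_mate p g f k h \<alpha> =
     (counit p h \<lhd> (push p f \<circ>\<^sub>F push p g))
     \<odot>\<^bsub>p\<^esub> (push p h \<rhd> (mate p g f k h \<alpha> \<lhd> push p g))
     \<odot>\<^bsub>p\<^esub> ((push p h \<circ>\<^sub>F push p k) \<rhd> unit p g)"


section \<open>Categories of objects with extra structure\<close>

text \<open>
  The category with objects \<open>S\<close>, pairs of an object of \<open>C\<close> and a structure morphism, whose morphisms
  \<open>(X, \<alpha>) \<rightarrow> (Y, \<beta>)\<close> are the morphisms \<open>h : X \<rightarrow> Y\<close> of \<open>C\<close> with \<open>R (X, \<alpha>) (Y, \<beta>) h\<close>. A morphism
  carries its domain and codomain.
\<close>

definition structured_cat ::
    "('o, 'm) cat \<Rightarrow> ('o \<times> 'm) set \<Rightarrow> ('o \<times> 'm \<Rightarrow> 'o \<times> 'm \<Rightarrow> 'm \<Rightarrow> bool)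
      \<Rightarrow> ('o \<times> 'm, ('o \<times> 'm) \<times> ('o \<times> 'm) \<times> 'm) cat" where
  "structured_cat C S R =
     \<lparr>Ob = S,
      Mor = {(x, y, h). x \<in> S \<and> y \<in> S \<and> h \<in> Hom C (fst x) (fst y) \<and> R x y h},
      Dom = (\<lambda>(x, y, h). x),
      Cod = (\<lambda>(x, y, h). y),
      Idm = (\<lambda>x. (x, x, Idm C (fst x))),
      Comp = (\<lambda>(y', z, g) (x, y, h). (x, z, g \<bullet>\<^bsub>C\<^esub> h))\<rparr>"

definition algebra_cat ::
    "('o, 'm) cat \<Rightarrow> ('o, 'm, 'o, 'm) funct \<Rightarrow> ('o \<Rightarrow> 'm) \<Rightarrow> ('o \<Rightarrow> 'm)
      \<Rightarrow> ('o \<times> 'm, ('o \<times> 'm) \<times> ('o \<times> 'm) \<times> 'm) cat" where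
  "algebra_cat C T \<eta> \<mu> = structured_cat C
     {(X, \<alpha>). X \<in> Ob C \<and> \<alpha> \<in> Hom C (on_ob T X) X
        \<and> \<alpha> \<bullet>\<^bsub>C\<^esub> \<eta> X = Idm C X \<and> \<alpha> \<bullet>\<^bsub>C\<^esub> \<mu> X = \<alpha> \<bullet>\<^bsub>C\<^esub> on_mor T \<alpha>}
     (\<lambda>(X, \<alpha>) (Y, \<alpha>') h. h \<bullet>\<^bsub>C\<^esub> \<alpha> = \<alpha>' \<bullet>\<^bsub>C\<^esub> on_mor T h)"

definition EM :: "('co, 'cm, 'eo, 'em) bifib \<Rightarrow> 'cm
    \<Rightarrow> ('eo \<times> 'em, ('eo \<times> 'em) \<times> ('eo \<times> 'em) \<times> 'em) cat" where
  "EM p f = algebra_cat (fiber p (Dom (base p) f)) (pull p f \<circ>\<^sub>F push p f)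
     (unit p f) (pull p f \<rhd> (counit p f \<lhd> push p f))"


section \<open>Descent data and actions\<close>

text \<open>
  Data of an internal category with source \<open>f\<^sub>1\<close>, target \<open>f\<^sub>2\<close>, identities \<open>\<Delta>\<close> and composition \<open>\<pi>\<close>
  defined on the pullback with projections \<open>\<pi>\<^sub>1, \<pi>\<^sub>2\<close>, where \<open>f\<^sub>2 \<bullet> \<pi>\<^sub>2 = f\<^sub>1 \<bullet> \<pi>\<^sub>1\<close>.
\<close>

record 'cm icat =
  src :: 'cm
  tgt :: 'cm
  idn :: 'cm
  cmp :: 'cm
  pr1 :: 'cm
  pr2 :: 'cm

text \<open>
  \<open>Eq C f\<^sub>1 f\<^sub>2 \<pi>\<^sub>1 \<pi>\<^sub>2\<close> is meant for a kernel pair \<open>f\<^sub>1, f\<^sub>2\<close> of some morphism, with \<open>\<pi>\<^sub>1, \<pi>\<^sub>2\<close> the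
  projections of a pullback square \<open>f\<^sub>2 \<bullet> \<pi>\<^sub>2 = f\<^sub>1 \<bullet> \<pi>\<^sub>1\<close>.
\<close>

definition Eq :: "('co, 'cm) cat \<Rightarrow> 'cm \<Rightarrow> 'cm \<Rightarrow> 'cm \<Rightarrow> 'cm \<Rightarrow> 'cm icat" where
  "Eq C f\<^sub>1 f\<^sub>2 \<pi>\<^sub>1 \<pi>\<^sub>2 =
     \<lparr>src = f\<^sub>1, tgt = f\<^sub>2,
      idn = (THE \<Delta>. \<Delta> \<in> Hom C (Cod C f\<^sub>1) (Dom C f\<^sub>1)
               \<and> f\<^sub>1 \<bullet>\<^bsub>C\<^esub> \<Delta> = Idm C (Cod C f\<^sub>1) \<and> f\<^sub>2 \<bullet>\<^bsub>C\<^esub> \<Delta> = Idm C (Cod C f\<^sub>1)),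
      cmp = (THE \<pi>. \<pi> \<in> Hom C (Dom C \<pi>\<^sub>1) (Dom C f\<^sub>1)
               \<and> f\<^sub>1 \<bullet>\<^bsub>C\<^esub> \<pi> = f\<^sub>1 \<bullet>\<^bsub>C\<^esub> \<pi>\<^sub>2 \<and> f\<^sub>2 \<bullet>\<^bsub>C\<^esub> \<pi> = f\<^sub>2 \<bullet>\<^bsub>C\<^esub> \<pi>\<^sub>1),
      pr1 = \<pi>\<^sub>1, pr2 = \<pi>\<^sub>2\<rparr>"

definition d1 :: "('co, 'cm, 'eo, 'em) bifib \<Rightarrow> 'cm icat \<Rightarrow> 'eo \<Rightarrow> 'em" where
  "d1 p K = inv_trans p (kappa p (src K) (idn K)) \<odot>\<^bsub>p\<^esub> iota p (Cod (base p) (src K))"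

definition d2 :: "('co, 'cm, 'eo, 'em) bifib \<Rightarrow> 'cm icat \<Rightarrow> 'eo \<Rightarrow> 'em" where
  "d2 p K = inv_trans p (kappa p (tgt K) (idn K)) \<odot>\<^bsub>p\<^esub> iota p (Cod (base p) (tgt K))"

definition j1 :: "('co, 'cm, 'eo, 'em) bifib \<Rightarrow> 'cm icat \<Rightarrow> 'eo \<Rightarrow> 'em" where
  "j1 p K = inv_trans p (kappa p (src K) (pr2 K)) \<odot>\<^bsub>p\<^esub> kappa p (src K) (cmp K)"

definition j2 :: "('co, 'cm, 'eo, 'em) bifib \<Rightarrow> 'cm icat \<Rightarrow> 'eo \<Rightarrow> 'em" where
  "j2 p K = inv_trans p (kappa p (tgt K) (pr1 K)) \<odot>\<^bsub>p\<^esub> kappa p (tgt K) (cmp K)"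

definition j12 :: "('co, 'cm, 'eo, 'em) bifib \<Rightarrow> 'cm icat \<Rightarrow> 'eo \<Rightarrow> 'em" where
  "j12 p K = inv_trans p (kappa p (src K) (pr1 K)) \<odot>\<^bsub>p\<^esub> kappa p (tgt K) (pr2 K)"

definition Desc :: "('co, 'cm, 'eo, 'em) bifib \<Rightarrow> 'cm icat
    \<Rightarrow> ('eo \<times> 'em, ('eo \<times> 'em) \<times> ('eo \<times> 'em) \<times> 'em) cat" where
  "Desc p K = structured_cat (fiber p (Cod (base p) (src K)))
     {(X, \<phi>). X \<in> Ob (fiber p (Cod (base p) (src K)))
        \<and> \<phi> \<in> Hom (fiber p (Dom (base p) (src K)))
                 (on_ob (pull p (src K)) X) (on_ob (pull p (tgt K)) X)
        \<and> is_iso (fiber p (Dom (base p) (src K))) \<phi>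
        \<and> inv_trans p (d2 p K) X \<bullet>\<^bsub>total_cat p\<^esub> on_mor (pull p (idn K)) \<phi> \<bullet>\<^bsub>total_cat p\<^esub> d1 p K X
            = Idm (total_cat p) X
        \<and> on_mor (pull p (pr1 K)) \<phi> \<bullet>\<^bsub>total_cat p\<^esub> j12 p K X \<bullet>\<^bsub>total_cat p\<^esub> on_mor (pull p (pr2 K)) \<phi>
            = j2 p K X \<bullet>\<^bsub>total_cat p\<^esub> on_mor (pull p (cmp K)) \<phi>
                \<bullet>\<^bsub>total_cat p\<^esub> inv_trans p (j1 p K) X}
     (\<lambda>(X, \<phi>) (Y, \<psi>) \<theta>. on_mor (pull p (tgt K)) \<theta> \<bullet>\<^bsub>total_cat p\<^esub> \<phi>
                          = \<psi> \<bullet>\<^bsub>total_cat p\<^esub> on_mor (pull p (src K)) \<theta>)"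

definition k2 :: "('co, 'cm, 'eo, 'em) bifib \<Rightarrow> 'cm icat \<Rightarrow> 'eo \<Rightarrow> 'em" where
  "k2 p K = twofold_mate p (cmp K) (tgt K) (pr1 K) (tgt K) (j2 p K)"

definition act_unit :: "('co, 'cm, 'eo, 'em) bifib \<Rightarrow> 'cm icat \<Rightarrow> 'eo \<Rightarrow> 'em" where
  "act_unit p K =
     (inv_trans p (d2 p K) \<lhd> (push p (tgt K) \<circ>\<^sub>F pull p (src K)))
     \<odot>\<^bsub>p\<^esub> (pull p (idn K) \<rhd> (unit p (tgt K) \<lhd> pull p (src K)))
     \<odot>\<^bsub>p\<^esub> d1 p K"

definition act_mult :: "('co, 'cm, 'eo, 'em) bifib \<Rightarrow> 'cm icat \<Rightarrow> 'eo \<Rightarrow> 'em" where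
  "act_mult p K =
     (push p (tgt K) \<rhd> (counit p (cmp K) \<lhd> pull p (src K)))
     \<odot>\<^bsub>p\<^esub> hcomp p (push p (tgt K) \<circ>\<^sub>F push p (pr1 K)) (k2 p K)
              (inv_trans p (j1 p K)) (pull p (cmp K) \<circ>\<^sub>F pull p (src K))
     \<odot>\<^bsub>p\<^esub> (push p (tgt K) \<rhd>
              (inv_trans p (BC p (pr2 K) (pr1 K) (src K) (tgt K)) \<lhd> pull p (src K)))"

definition Act :: "('co, 'cm, 'eo, 'em) bifib \<Rightarrow> 'cm icat
    \<Rightarrow> ('eo \<times> 'em, ('eo \<times> 'em) \<times> ('eo \<times> 'em) \<times> 'em) cat" where
  "Act p K = algebra_cat (fiber p (Cod (base p) (src K)))
     (push p (tgt K) \<circ>\<^sub>F pull p (src K)) (act_unit p K) (act_mult p K)"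

end

theory Submission
  imports Defs
begin

text \<open>
  All three categories are isomorphic, over the fiber of \<open>B\<close>, to the category of pairs \<open>(X, u)\<close> with
  \<open>u : f\<^sub>1\<^sup>*X \<rightarrow> X\<close> a morphism over \<open>f\<^sub>2\<close> that satisfies a unit and an associativity law. A vertical
  \<open>\<phi> : f\<^sub>1\<^sup>*X \<rightarrow> f\<^sub>2\<^sup>*X\<close> corresponds to its composite with the cartesian lift of \<open>f\<^sub>2\<close>; a vertical
  \<open>\<beta> : (f\<^sub>2)\<^sub>!f\<^sub>1\<^sup>*X \<rightarrow> X\<close> to its composite with the cocartesian lift of \<open>f\<^sub>2\<close>; a vertical
  \<open>\<alpha> : f\<^sup>*f\<^sub>!X \<rightarrow> X\<close> to its composite with the comparison \<open>f\<^sub>1\<^sup>*X \<rightarrow> f\<^sup>*f\<^sub>!X\<close> over \<open>f\<^sub>2\<close>, which is cocartesian by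
  the Beck--Chevalley condition for the kernel pair. The Beck--Chevalley condition for the square of
  \<open>\<pi>\<^sub>1, \<pi>\<^sub>2\<close> provides a cocartesian morphism out of \<open>\<pi>\<^sub>2\<^sup>*f\<^sub>1\<^sup>*X\<close> against which the associativity laws
  can be tested. Working in the total category, every mate and canonical isomorphism is
  determined by its composites with cartesian and cocartesian lifts. Finally, invertibility of \<open>\<phi>\<close>
  is automatic: the swap of the kernel pair yields the inverse.
\<close>

section \<open>Categories\<close>

context category
begin

lemma in_HomI [intro]: "\<lbrakk>f \<in> Mor C; Dom C f = X; Cod C f = Y\<rbrakk> \<Longrightarrow> f \<in> Hom C X Y"
  by (simp add: Hom_def)

lemma dom_cod_ob [simp]: "f \<in> Mor C \<Longrightarrow> Dom C f \<in> Ob C" "f \<in> Mor C \<Longrightarrow> Cod C f \<in> Ob C"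
  by (auto intro: dom_ob cod_ob)

lemma id_simps [simp]:
  "X \<in> Ob C \<Longrightarrow> Idm C X \<in> Mor C" "X \<in> Ob C \<Longrightarrow> Dom C (Idm C X) = X"
  "X \<in> Ob C \<Longrightarrow> Cod C (Idm C X) = X"
  using id_hom[of X] by (auto simp: Hom_def)

lemma comp_simps [simp]:
  assumes "f \<in> Mor C" "g \<in> Mor C" "Cod C f = Dom C g"
  shows "g \<bullet> f \<in> Mor C" "Dom C (g \<bullet> f) = Dom C f" "Cod C (g \<bullet> f) = Cod C g"
  using comp_hom[of f "Dom C f" "Dom C g" g "Cod C g"] assms by (auto simp: Hom_def)

lemma comp_id_simps [simp]:
  "\<lbrakk>f \<in> Mor C; Dom C f = X\<rbrakk> \<Longrightarrow> f \<bullet> Idm C X = f"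
  "\<lbrakk>f \<in> Mor C; Cod C f = X\<rbrakk> \<Longrightarrow> Idm C X \<bullet> f = f"
  using comp_id_right comp_id_left by blast+

lemma assoc [simp]:
  "\<lbrakk>f \<in> Mor C; g \<in> Mor C; h \<in> Mor C; Cod C f = Dom C g; Cod C g = Dom C h\<rbrakk>
   \<Longrightarrow> (h \<bullet> g) \<bullet> f = h \<bullet> (g \<bullet> f)"
  using comp_assoc by blast

lemma is_inverse_unique:
  assumes "is_inverse C f g" "is_inverse C f h"
  shows "g = h"
proof -
  have "g = (h \<bullet> f) \<bullet> g" using assms by (simp add: is_inverse_def Hom_def)
  also have "\<dots> = h \<bullet> (f \<bullet> g)" using assms by (intro assoc) (auto simp: is_inverse_def Hom_def)
  also have "\<dots> = h" using assms by (simp add: is_inverse_def Hom_def)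
  finally show ?thesis .
qed

lemma inverse_of_eq: "is_inverse C f g \<Longrightarrow> inverse_of C f = g"
  unfolding inverse_of_def using is_inverse_unique by blast

lemma is_inverse_inverse_of: "is_iso C f \<Longrightarrow> is_inverse C f (inverse_of C f)"
  unfolding is_iso_def using inverse_of_eq by blast

lemma inverse_of_simps [simp]:
  assumes "is_iso C f"
  shows "inverse_of C f \<in> Mor C" "Dom C (inverse_of C f) = Cod C f"
    "Cod C (inverse_of C f) = Dom C f" "inverse_of C f \<bullet> f = Idm C (Dom C f)"
    "f \<bullet> inverse_of C f = Idm C (Cod C f)"
  using is_inverse_inverse_of[OF assms] by (auto simp: is_inverse_def Hom_def)

end

lemma (in category) is_iso_id [simp]: "X \<in> Ob C \<Longrightarrow> is_iso C (Idm C X)"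
  unfolding is_iso_def is_inverse_def by (intro exI[of _ "Idm C X"]) (auto simp: Hom_def)

section \<open>Structured objects over a category and equivalences between such categories\<close>

lemma structured_cat_simps [simp]:
  "Ob (structured_cat C S R) = S"
  "(x, y, h) \<in> Mor (structured_cat C S R) \<longleftrightarrow>
     x \<in> S \<and> y \<in> S \<and> h \<in> Hom C (fst x) (fst y) \<and> R x y h"
  "Dom (structured_cat C S R) (x, y, h) = x"
  "Cod (structured_cat C S R) (x, y, h) = y"
  "Idm (structured_cat C S R) x = (x, x, Idm C (fst x))"
  "Comp (structured_cat C S R) (y', z, g) (x, y, h) = (x, z, g \<bullet>\<^bsub>C\<^esub> h)"
  by (simp_all add: structured_cat_def)

lemma structured_cat_Hom [simp]:
  "m \<in> Hom (structured_cat C S R) x y \<longleftrightarrow>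
     (\<exists>h. m = (x, y, h) \<and> x \<in> S \<and> y \<in> S \<and> h \<in> Hom C (fst x) (fst y) \<and> R x y h)"
  by (cases m) (auto simp: Hom_def)

text \<open>\<open>structured_cat\<close> accepts arbitrary \<open>S\<close> and \<open>R\<close>.
  The conditions here make it a category: underlying objects lie in \<open>C\<close>, and
  \<open>R\<close> contains identities and is closed under composition.\<close>

locale structured = category C
  for C :: "('o, 'm) cat" +
  fixes S :: "('o \<times> 'm) set" and R :: "'o \<times> 'm \<Rightarrow> 'o \<times> 'm \<Rightarrow> 'm \<Rightarrow> bool"
  assumes S_ob: "x \<in> S \<Longrightarrow> fst x \<in> Ob C"
    and R_id: "x \<in> S \<Longrightarrow> R x x (Idm C (fst x))"
    and R_comp: "\<lbrakk>x \<in> S; y \<in> S; z \<in> S; h \<in> Hom C (fst x) (fst y);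
      g \<in> Hom C (fst y) (fst z); R x y h; R y z g\<rbrakk> \<Longrightarrow> R x z (g \<bullet>\<^bsub>C\<^esub> h)"
begin

sublocale cat: category "structured_cat C S R"
proof
  fix f assume "f \<in> Mor (structured_cat C S R)"
  then show "Dom (structured_cat C S R) f \<in> Ob (structured_cat C S R)"
    "Cod (structured_cat C S R) f \<in> Ob (structured_cat C S R)" by (cases f; auto)+
next
  fix f g x y z
  assume "f \<in> Hom (structured_cat C S R) x y" "g \<in> Hom (structured_cat C S R) y z"
  then show "g \<bullet>\<^bsub>structured_cat C S R\<^esub> f \<in> Hom (structured_cat C S R) x z"
    by (clarsimp simp: comp_hom[of _ "fst x" "fst y"] R_comp[of x y z])
next
  fix f g h x y z w
  assume "f \<in> Hom (structured_cat C S R) x y" "g \<in> Hom (structured_cat C S R) y z"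
    "h \<in> Hom (structured_cat C S R) z w"
  then show "(h \<bullet>\<^bsub>structured_cat C S R\<^esub> g) \<bullet>\<^bsub>structured_cat C S R\<^esub> f =
      h \<bullet>\<^bsub>structured_cat C S R\<^esub> (g \<bullet>\<^bsub>structured_cat C S R\<^esub> f)"
    by (clarsimp simp: comp_assoc)
qed (auto simp: S_ob R_id id_hom comp_id_left comp_id_right)

end

text \<open>A bijection that keeps underlying objects, together with the identity on underlying
  morphisms, is an invertible functor; its inverse comes from \<open>inv_into\<close>. Both
  composites are identities on the carriers, so identity morphisms serve as the natural
  isomorphisms.\<close>

lemma equivalent_structured_cats:
  fixes C :: "('o, 'm) cat"
  assumes "structured C S R" and "structured C S' R'"
    and \<Phi>: "bij_betw \<Phi> S S'" "\<And>x. x \<in> S \<Longrightarrow> fst (\<Phi> x) = fst x"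
    and R': "\<And>x y h. \<lbrakk>x \<in> S; y \<in> S; h \<in> Hom C (fst x) (fst y)\<rbrakk> \<Longrightarrow> R' (\<Phi> x) (\<Phi> y) h \<longleftrightarrow> R x y h"
  shows "equivalent_categories (structured_cat C S R) (structured_cat C S' R')"
proof -
  let ?D = "structured_cat C S R" and ?D' = "structured_cat C S' R'"
  interpret D: structured C S R by (fact assms(1))
  interpret D': structured C S' R' by (fact assms(2))
  define \<Psi> where "\<Psi> = inv_into S \<Phi>"
  have \<Phi>S: "\<Phi> x \<in> S'" if "x \<in> S" for x using that \<Phi>(1) by (auto simp: bij_betw_def)
  have \<Psi>S: "\<Psi> x \<in> S" if "x \<in> S'" for x
    using that \<Phi>(1) by (auto simp: bij_betw_def \<Psi>_def inv_into_into)
  have \<Phi>\<Psi>: "\<Phi> (\<Psi> x) = x" if "x \<in> S'" for x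
    using that \<Phi>(1) by (simp add: bij_betw_inv_into_right \<Psi>_def)
  have \<Psi>\<Phi>: "\<Psi> (\<Phi> x) = x" if "x \<in> S" for x
    using that \<Phi>(1) by (simp add: bij_betw_inv_into_left \<Psi>_def)
  have fst\<Psi>: "fst (\<Psi> x) = fst x" if "x \<in> S'" for x
    using \<Phi>(2)[OF \<Psi>S[OF that]] \<Phi>\<Psi>[OF that] by simp
  have R\<Psi>: "R (\<Psi> x) (\<Psi> y) h \<longleftrightarrow> R' x y h"
    if "x \<in> S'" "y \<in> S'" "h \<in> Hom C (fst x) (fst y)" for x y h
    using R'[of "\<Psi> x" "\<Psi> y" h] that by (simp add: \<Psi>S \<Phi>\<Psi> fst\<Psi>)
  define F where "F = \<lparr>on_ob = \<Phi>, on_mor = (\<lambda>(x, y, h :: 'm). (\<Phi> x, \<Phi> y, h))\<rparr>"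
  define G where "G = \<lparr>on_ob = \<Psi>, on_mor = (\<lambda>(x, y, h :: 'm). (\<Psi> x, \<Psi> y, h))\<rparr>"
  interpret F: is_functor ?D ?D' F
  proof
    show "on_mor F f \<in> Hom ?D' (on_ob F x) (on_ob F y)" if "f \<in> Hom ?D x y" for f x y
      using that by (clarsimp simp: F_def \<Phi>S \<Phi>(2) R')
    show "on_mor F (g \<bullet>\<^bsub>?D\<^esub> f) = on_mor F g \<bullet>\<^bsub>?D'\<^esub> on_mor F f"
      if "f \<in> Hom ?D x y" "g \<in> Hom ?D y z" for f g x y z
      using that by (clarsimp simp: F_def)
  qed (simp_all add: F_def \<Phi>S \<Phi>(2))
  interpret G: is_functor ?D' ?D G
  proof
    show "on_mor G f \<in> Hom ?D (on_ob G x) (on_ob G y)" if "f \<in> Hom ?D' x y" for f x y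
      using that by (clarsimp simp: G_def \<Psi>S fst\<Psi> R\<Psi>)
    show "on_mor G (g \<bullet>\<^bsub>?D'\<^esub> f) = on_mor G g \<bullet>\<^bsub>?D\<^esub> on_mor G f"
      if "f \<in> Hom ?D' x y" "g \<in> Hom ?D' y z" for f g x y z
      using that by (clarsimp simp: G_def)
  qed (simp_all add: G_def \<Psi>S fst\<Psi>)
  have GF: "natural_isomorphism ?D ?D id_funct (G \<circ>\<^sub>F F) (Idm ?D)"
  proof
    fix x assume "x \<in> Ob ?D"
    then show "is_iso ?D (Idm ?D x)" by (rule D.cat.is_iso_id)
  qed (auto simp: id_funct_def comp_funct_def F_def G_def \<Psi>\<Phi> D.S_ob D.R_id D.id_hom
      D.comp_id_left D.comp_id_right)
  have FG: "natural_isomorphism ?D' ?D' (F \<circ>\<^sub>F G) id_funct (Idm ?D')"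
  proof
    fix x assume "x \<in> Ob ?D'"
    then show "is_iso ?D' (Idm ?D' x)" by (rule D'.cat.is_iso_id)
  qed (auto simp: id_funct_def comp_funct_def F_def G_def \<Phi>\<Psi> D'.S_ob D'.R_id D.id_hom
      D.comp_id_left D.comp_id_right)
  show ?thesis unfolding equivalent_categories_def
    using F.is_functor_axioms G.is_functor_axioms GF FG by blast
qed

text \<open>Each of the two categories is matched with a common third one, and the bijection between
  them goes through it. The category axioms are assumed for \<open>U\<close> and \<open>Q\<close>
  only and transferred along the bijections.\<close>

lemma equivalent_structured_cats_over:
  assumes U: "structured C U Q"
    and \<Phi>: "bij_betw \<Phi> S U" "\<And>x. x \<in> S \<Longrightarrow> fst (\<Phi> x) = fst x"
    and R: "\<And>x y h. \<lbrakk>x \<in> S; y \<in> S; h \<in> Hom C (fst x) (fst y)\<rbrakk> \<Longrightarrow> R x y h \<longleftrightarrow> Q (\<Phi> x) (\<Phi> y) h"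
    and \<Phi>': "bij_betw \<Phi>' S' U" "\<And>x. x \<in> S' \<Longrightarrow> fst (\<Phi>' x) = fst x"
    and R': "\<And>x y h. \<lbrakk>x \<in> S'; y \<in> S'; h \<in> Hom C (fst x) (fst y)\<rbrakk> \<Longrightarrow> R' x y h \<longleftrightarrow> Q (\<Phi>' x) (\<Phi>' y) h"
  shows "equivalent_categories (structured_cat C S R) (structured_cat C S' R')"
proof -
  have transfer: "structured C T W"
    if \<phi>: "bij_betw \<phi> T U" "\<And>x. x \<in> T \<Longrightarrow> fst (\<phi> x) = fst x"
    and W: "\<And>x y h. \<lbrakk>x \<in> T; y \<in> T; h \<in> Hom C (fst x) (fst y)\<rbrakk> \<Longrightarrow> W x y h \<longleftrightarrow> Q (\<phi> x) (\<phi> y) h"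
    for \<phi> T W
  proof -
    interpret U: structured C U Q by (fact U)
    have \<phi>T: "\<phi> x \<in> U" if "x \<in> T" for x using that \<phi>(1) by (auto simp: bij_betw_def)
    have ob: "fst x \<in> Ob C" if "x \<in> T" for x using U.S_ob[OF \<phi>T[OF that]] \<phi>(2)[OF that] by simp
    show ?thesis
    proof
      show "fst x \<in> Ob C" if "x \<in> T" for x using ob that .
      show "W x x (Idm C (fst x))" if "x \<in> T" for x
        using that U.R_id[OF \<phi>T[OF that]] by (simp add: W \<phi>(2) ob U.id_hom)
      show "W x z (g \<bullet>\<^bsub>C\<^esub> h)" if "x \<in> T" "y \<in> T" "z \<in> T" "h \<in> Hom C (fst x) (fst y)"
        "g \<in> Hom C (fst y) (fst z)" "W x y h" "W y z g" for x y z g h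
        using U.R_comp[of "\<phi> x" "\<phi> y" "\<phi> z" h g] that U.comp_hom[OF that(4,5)]
        by (simp add: W \<phi>T \<phi>(2))
    qed
  qed
  have \<Phi>S: "\<Phi> x \<in> U" if "x \<in> S" for x using that \<Phi>(1) by (auto simp: bij_betw_def)
  have inv: "inv_into S' \<Phi>' x \<in> S'" "\<Phi>' (inv_into S' \<Phi>' x) = x" if "x \<in> U" for x
    using that \<Phi>'(1) by (auto simp: bij_betw_def inv_into_into f_inv_into_f)
  have fst_inv: "fst (inv_into S' \<Phi>' x) = fst x" if "x \<in> U" for x
    using \<Phi>'(2)[OF inv(1)[OF that]] inv(2)[OF that] by simp
  show ?thesis
  proof (rule equivalent_structured_cats[where \<Phi> = "inv_into S' \<Phi>' \<circ> \<Phi>"])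
    show "structured C S R" using \<Phi> R by (rule transfer)
    show "structured C S' R'" using \<Phi>' R' by (rule transfer)
    show "bij_betw (inv_into S' \<Phi>' \<circ> \<Phi>) S S'"
      using \<Phi>(1) \<Phi>'(1) bij_betw_inv_into bij_betw_trans by blast
    show "fst ((inv_into S' \<Phi>' \<circ> \<Phi>) x) = fst x" if "x \<in> S" for x
      using that by (simp add: fst_inv \<Phi>S \<Phi>)
    show "R' ((inv_into S' \<Phi>' \<circ> \<Phi>) x) ((inv_into S' \<Phi>' \<circ> \<Phi>) y) h \<longleftrightarrow> R x y h"
      if "x \<in> S" "y \<in> S" "h \<in> Hom C (fst x) (fst y)" for x y h
      using that by (simp add: R R' inv \<Phi>S fst_inv \<Phi>)
  qed
qed

section \<open>Cloven bifibrations\<close>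

context cloven_bifibration
begin

sublocale proj: is_functor "total_cat p" "base p" "proj p"
  by (fact proj_functor)

abbreviation Comp_total (infixr "\<cdot>" 70) where "g \<cdot> f \<equiv> g \<bullet>\<^bsub>total_cat p\<^esub> f"
abbreviation Comp_base (infixr "\<star>" 70) where "g \<star> f \<equiv> g \<bullet>\<^bsub>base p\<^esub> f"
abbreviation "E \<equiv> total_cat p"
abbreviation "B \<equiv> base p"
abbreviation "P \<equiv> on_mor (proj p)"
abbreviation "P\<^sub>o \<equiv> on_ob (proj p)"
abbreviation "pull_ob f X \<equiv> on_ob (pull p f) X"
abbreviation "push_ob f X \<equiv> on_ob (push p f) X"

lemma proj_simps [simp]:
  "X \<in> Ob E \<Longrightarrow> P\<^sub>o X \<in> Ob B"
  "e \<in> Mor E \<Longrightarrow> P e \<in> Mor B"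
  "e \<in> Mor E \<Longrightarrow> P\<^sub>o (Dom E e) = Dom B (P e)"
  "e \<in> Mor E \<Longrightarrow> P\<^sub>o (Cod E e) = Cod B (P e)"
  "X \<in> Ob E \<Longrightarrow> P (Idm E X) = Idm B (P\<^sub>o X)"
  using proj.ob proj.hom[of e "Dom E e" "Cod E e"] proj.map_id by (auto simp: Hom_def)

lemma proj_comp [simp]:
  "\<lbrakk>e \<in> Mor E; e' \<in> Mor E; Cod E e = Dom E e'\<rbrakk> \<Longrightarrow> P (e' \<cdot> e) = P e' \<star> P e"
  using proj.map_comp[of e "Dom E e" "Dom E e'" e' "Cod E e'"] by (auto simp: Hom_def)

text \<open>Simplification nests composites to the right, which hides a known composite
  \<open>a \<cdot> b\<close> standing before a further factor. This lemma rewrites it there; the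
  variants with a tail \<open>x\<close> in later simplification rules serve the same
  purpose.\<close>

lemma reassoc:
  assumes "a \<cdot> b = c" "x \<in> Mor E" "a \<in> Mor E" "b \<in> Mor E" "Cod E b = Dom E a" "Cod E x = Dom E b"
  shows "a \<cdot> (b \<cdot> x) = c \<cdot> x"
  using assms by (metis proj.C.assoc)

lemma fiber_simps [simp]:
  "X \<in> Ob (fiber p A) \<longleftrightarrow> X \<in> Ob E \<and> P\<^sub>o X = A"
  "e \<in> Mor (fiber p A) \<longleftrightarrow> e \<in> Mor E \<and> P e = Idm B A \<and> P\<^sub>o (Dom E e) = A \<and> P\<^sub>o (Cod E e) = A"
  "Dom (fiber p A) = Dom E" "Cod (fiber p A) = Cod E" "Idm (fiber p A) = Idm E"
  "Comp (fiber p A) = Comp E"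
  by (auto simp: fiber_def)

lemma Hom_fiber: "e \<in> Hom (fiber p A) X Y \<longleftrightarrow>
    e \<in> Mor E \<and> P e = Idm B A \<and> Dom E e = X \<and> Cod E e = Y \<and> P\<^sub>o X = A \<and> P\<^sub>o Y = A"
  by (auto simp: Hom_def)

lemma category_fiber: "category (fiber p A)"
proof
  show "g \<bullet>\<^bsub>fiber p A\<^esub> f \<in> Hom (fiber p A) X Z"
    if "f \<in> Hom (fiber p A) X Y" "g \<in> Hom (fiber p A) Y Z" for f g X Y Z
  proof -
    \<comment> \<open>Composing two identities of \<open>A\<close> presupposes that \<open>A\<close>
      is an object of the base; an object lying over \<open>A\<close> guarantees it.\<close>
    have "A \<in> Ob B" using that(1) proj_simps(1) proj.C.dom_cod_ob(1) unfolding Hom_fiber by metis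
    then show ?thesis using that by (clarsimp simp: Hom_fiber)
  qed
  show "(h \<bullet>\<^bsub>fiber p A\<^esub> g) \<bullet>\<^bsub>fiber p A\<^esub> f = h \<bullet>\<^bsub>fiber p A\<^esub> (g \<bullet>\<^bsub>fiber p A\<^esub> f)"
    if "f \<in> Hom (fiber p A) X Y" "g \<in> Hom (fiber p A) Y Z" "h \<in> Hom (fiber p A) Z W"
    for f g h X Y Z W
    using that by (clarsimp simp: Hom_fiber)
qed (simp_all add: Hom_fiber)

subsection \<open>Cartesian and cocartesian morphisms\<close>

text \<open>Unfolding the hom-sets turns the side conditions of the universal property into
  equations between domains and codomains, within reach of the simplifier.\<close>

lemma cartesian_ex1:
  assumes "is_cartesian p e" "z \<in> Mor E" "Cod E z = Cod E e" "g \<in> Mor B"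
    "Dom B g = Dom B (P z)" "Cod B g = Dom B (P e)" "P e \<star> g = P z"
  shows "\<exists>!v. v \<in> Mor E \<and> Dom E v = Dom E z \<and> Cod E v = Dom E e \<and> P v = g \<and> e \<cdot> v = z"
  using assms unfolding is_cartesian_def
  by (elim conjE allE[of _ "Dom E z"] allE[of _ z] allE[of _ g]) (simp add: Hom_def conj_ac)

lemma cocartesian_ex1:
  assumes "is_cocartesian p e" "z \<in> Mor E" "Dom E z = Dom E e" "g \<in> Mor B"
    "Dom B g = Cod B (P e)" "Cod B g = Cod B (P z)" "g \<star> P e = P z"
  shows "\<exists>!v. v \<in> Mor E \<and> Dom E v = Cod E e \<and> Cod E v = Cod E z \<and> P v = g \<and> v \<cdot> e = z"
  using assms unfolding is_cocartesian_def
  by (elim conjE allE[of _ "Cod E z"] allE[of _ z] allE[of _ g]) (simp add: Hom_def conj_ac)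

text \<open>Both morphisms are factorisations of \<open>e \<cdot> w\<close> over the same base
  morphism, and such a factorisation is unique. Many equations below are reduced in this way to
  equations between composites of lifts.\<close>

lemma cartesian_cancel:
  assumes "is_cartesian p e" "e \<cdot> v = e \<cdot> w" "v \<in> Mor E" "w \<in> Mor E"
    "Dom E v = Dom E w" "Cod E v = Dom E e" "Cod E w = Dom E e" "P v = P w"
  shows "v = w"
proof -
  have [simp]: "e \<in> Mor E" using assms(1) by (simp add: is_cartesian_def)
  have "Cod B (P v) = Dom B (P e)" using proj_simps(4)[of v] assms by simp
  then show ?thesis
    using cartesian_ex1[of e "e \<cdot> w" "P v"] assms by auto
qed

lemma cocartesian_cancel:
  assumes "is_cocartesian p e" "v \<cdot> e = w \<cdot> e" "v \<in> Mor E" "w \<in> Mor E"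
    "Cod E v = Cod E w" "Dom E v = Cod E e" "Dom E w = Cod E e" "P v = P w"
  shows "v = w"
proof -
  have [simp]: "e \<in> Mor E" using assms(1) by (simp add: is_cocartesian_def)
  have "Dom B (P v) = Cod B (P e)" using proj_simps(3)[of v] assms by simp
  then show ?thesis
    using cocartesian_ex1[of e "w \<cdot> e" "P v"] assms by auto
qed

text \<open>Naming the factorisation as a term allows the action laws to nest such lifts. The value
  is meaningful under the hypotheses of \<open>lift_simps\<close>.\<close>

definition lift where
  "lift e z g = (THE v. v \<in> Mor E \<and> Dom E v = Dom E z \<and> Cod E v = Dom E e \<and> P v = g \<and> e \<cdot> v = z)"

lemma lift_simps [simp]:
  assumes "is_cartesian p e" "z \<in> Mor E" "Cod E z = Cod E e" "g \<in> Mor B"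
    "Dom B g = Dom B (P z)" "Cod B g = Dom B (P e)" "P e \<star> g = P z"
  shows "lift e z g \<in> Mor E" "Dom E (lift e z g) = Dom E z" "Cod E (lift e z g) = Dom E e"
    "P (lift e z g) = g" "e \<cdot> lift e z g = z"
  using theI'[OF cartesian_ex1[OF assms]] by (auto simp: lift_def)

lemma cartesian_mor [simp]: "is_cartesian p e \<Longrightarrow> e \<in> Mor E"
  by (simp add: is_cartesian_def)

lemma cocartesian_mor [simp]: "is_cocartesian p e \<Longrightarrow> e \<in> Mor E"
  by (simp add: is_cocartesian_def)

text \<open>The universal property over an identity of the base. \<open>A\<close>, \<open>X\<close>
  and \<open>Y\<close> are tied by equations so that the rule matches the descriptions defining
  \<open>pull\<close>, \<open>unit\<close>, \<open>iota\<close> and \<open>kappa\<close>.\<close>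

lemma fiber_lift_ex1:
  assumes "is_cartesian p e" "z \<in> Mor E" "Cod E z = Cod E e" "P z = P e" "A = Dom B (P e)"
    "X = Dom E z" "Y = Dom E e"
  shows "\<exists>!v. v \<in> Hom (fiber p A) X Y \<and> e \<cdot> v = z"
proof -
  have "\<exists>!v. v \<in> Mor E \<and> Dom E v = Dom E z \<and> Cod E v = Dom E e \<and> P v = Idm B (Dom B (P e)) \<and> e \<cdot> v = z"
    using assms by (intro cartesian_ex1) simp_all
  then show ?thesis using assms by (simp add: Hom_fiber conj_ac)
qed

lemma fiber_colift_ex1:
  assumes "is_cocartesian p e" "z \<in> Mor E" "Dom E z = Dom E e" "P z = P e" "A = Cod B (P e)"
    "X = Cod E e" "Y = Cod E z"
  shows "\<exists>!v. v \<in> Hom (fiber p A) X Y \<and> v \<cdot> e = z"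
proof -
  have "\<exists>!v. v \<in> Mor E \<and> Dom E v = Cod E e \<and> Cod E v = Cod E z \<and> P v = Idm B (Cod B (P e)) \<and> v \<cdot> e = z"
    using assms by (intro cocartesian_ex1) simp_all
  then show ?thesis using assms by (simp add: Hom_fiber conj_ac)
qed

section \<open>Chosen lifts, the functors between fibers, unit and counit\<close>

lemma cart_simps [simp]:
  assumes "f \<in> Mor B" "X \<in> Ob E" "P\<^sub>o X = Cod B f"
  shows "is_cartesian p (cart p f X)" "cart p f X \<in> Mor E" "Cod E (cart p f X) = X"
    "Dom E (cart p f X) = pull_ob f X" "P (cart p f X) = f"
    "pull_ob f X \<in> Ob E" "P\<^sub>o (pull_ob f X) = Dom B f"
proof -
  have *: "is_cartesian p (cart p f X) \<and> Cod E (cart p f X) = X \<and> P (cart p f X) = f"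
    using assms by (intro cart_lift[of f "Dom B f" "Cod B f"]) (auto simp: Hom_def)
  then have [simp]: "cart p f X \<in> Mor E" by simp
  show "Dom E (cart p f X) = pull_ob f X" by (simp add: pull_def)
  show "pull_ob f X \<in> Ob E" by (simp add: pull_def)
  show "P\<^sub>o (pull_ob f X) = Dom B f" using * by (simp add: pull_def)
  show "is_cartesian p (cart p f X)" "cart p f X \<in> Mor E" "Cod E (cart p f X) = X"
    "P (cart p f X) = f" using * by simp_all
qed

lemma cocart_simps [simp]:
  assumes "f \<in> Mor B" "X \<in> Ob E" "P\<^sub>o X = Dom B f"
  shows "is_cocartesian p (cocart p f X)" "cocart p f X \<in> Mor E" "Dom E (cocart p f X) = X"
    "Cod E (cocart p f X) = push_ob f X" "P (cocart p f X) = f"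
    "push_ob f X \<in> Ob E" "P\<^sub>o (push_ob f X) = Cod B f"
proof -
  have *: "is_cocartesian p (cocart p f X) \<and> Dom E (cocart p f X) = X \<and> P (cocart p f X) = f"
    using assms by (intro cocart_lift[of f "Dom B f" "Cod B f"]) (auto simp: Hom_def)
  then have [simp]: "cocart p f X \<in> Mor E" by simp
  show "Cod E (cocart p f X) = push_ob f X" by (simp add: push_def)
  show "push_ob f X \<in> Ob E" by (simp add: push_def)
  show "P\<^sub>o (push_ob f X) = Cod B f" using * by (simp add: push_def)
  show "is_cocartesian p (cocart p f X)" "cocart p f X \<in> Mor E" "Dom E (cocart p f X) = X"
    "P (cocart p f X) = f" using * by simp_all
qed

lemma pull_mor:
  assumes "f \<in> Mor B" "e \<in> Mor E" "P e = Idm B (Cod B f)"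
  shows "on_mor (pull p f) e \<in> Hom (fiber p (Dom B f)) (pull_ob f (Dom E e)) (pull_ob f (Cod E e))
    \<and> cart p f (Cod E e) \<cdot> on_mor (pull p f) e = e \<cdot> cart p f (Dom E e)"
proof -
  have [simp]: "P\<^sub>o (Dom E e) = Cod B f" "P\<^sub>o (Cod E e) = Cod B f" using assms by simp_all
  have "\<exists>!v. v \<in> Hom (fiber p (Dom B f)) (pull_ob f (Dom E e)) (pull_ob f (Cod E e))
      \<and> cart p f (Cod E e) \<cdot> v = e \<cdot> cart p f (Dom E e)"
    using assms by (intro fiber_lift_ex1) simp_all
  from theI'[OF this] show ?thesis by (simp add: pull_def Let_def)
qed

lemma pull_mor_simps [simp]:
  assumes "f \<in> Mor B" "e \<in> Mor E" "P e = Idm B (Cod B f)"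
  shows "on_mor (pull p f) e \<in> Mor E" "Dom E (on_mor (pull p f) e) = pull_ob f (Dom E e)"
    "Cod E (on_mor (pull p f) e) = pull_ob f (Cod E e)" "P (on_mor (pull p f) e) = Idm B (Dom B f)"
  using pull_mor[OF assms] by (simp_all add: Hom_fiber)

lemma cart_natural [simp]:
  assumes "f \<in> Mor B" "e \<in> Mor E" "P e = Idm B (Cod B f)" "Cod E e = Y"
  shows "cart p f Y \<cdot> on_mor (pull p f) e = e \<cdot> cart p f (Dom E e)"
    "\<lbrakk>x \<in> Mor E; Cod E x = pull_ob f (Dom E e)\<rbrakk> \<Longrightarrow>
      cart p f Y \<cdot> (on_mor (pull p f) e \<cdot> x) = e \<cdot> (cart p f (Dom E e) \<cdot> x)"
proof -
  have [simp]: "P\<^sub>o (Dom E e) = Cod B f" "P\<^sub>o Y = Cod B f" "Y \<in> Ob E"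
    using assms(1-3) by (simp_all flip: assms(4))
  show *: "cart p f Y \<cdot> on_mor (pull p f) e = e \<cdot> cart p f (Dom E e)"
    using pull_mor[OF assms(1-3)] assms(4) by simp
  show "cart p f Y \<cdot> (on_mor (pull p f) e \<cdot> x) = e \<cdot> (cart p f (Dom E e) \<cdot> x)"
    if "x \<in> Mor E" "Cod E x = pull_ob f (Dom E e)"
    using reassoc[OF *, of x] that assms by simp
qed

lemma push_mor:
  assumes "f \<in> Mor B" "e \<in> Mor E" "P e = Idm B (Dom B f)"
  shows "on_mor (push p f) e \<in> Hom (fiber p (Cod B f)) (push_ob f (Dom E e)) (push_ob f (Cod E e))
    \<and> on_mor (push p f) e \<cdot> cocart p f (Dom E e) = cocart p f (Cod E e) \<cdot> e"
proof -
  have [simp]: "P\<^sub>o (Dom E e) = Dom B f" "P\<^sub>o (Cod E e) = Dom B f" using assms by simp_all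
  have "\<exists>!v. v \<in> Hom (fiber p (Cod B f)) (push_ob f (Dom E e)) (push_ob f (Cod E e))
      \<and> v \<cdot> cocart p f (Dom E e) = cocart p f (Cod E e) \<cdot> e"
    using assms by (intro fiber_colift_ex1) simp_all
  from theI'[OF this] show ?thesis by (simp add: push_def Let_def)
qed

lemma push_mor_simps [simp]:
  assumes "f \<in> Mor B" "e \<in> Mor E" "P e = Idm B (Dom B f)"
  shows "on_mor (push p f) e \<in> Mor E" "Dom E (on_mor (push p f) e) = push_ob f (Dom E e)"
    "Cod E (on_mor (push p f) e) = push_ob f (Cod E e)" "P (on_mor (push p f) e) = Idm B (Cod B f)"
  using push_mor[OF assms] by (simp_all add: Hom_fiber)

lemma cocart_natural [simp]:
  assumes "f \<in> Mor B" "e \<in> Mor E" "P e = Idm B (Dom B f)" "Dom E e = X"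
  shows "on_mor (push p f) e \<cdot> cocart p f X = cocart p f (Cod E e) \<cdot> e"
    "\<lbrakk>x \<in> Mor E; Cod E x = X\<rbrakk> \<Longrightarrow>
      on_mor (push p f) e \<cdot> (cocart p f X \<cdot> x) = cocart p f (Cod E e) \<cdot> (e \<cdot> x)"
proof -
  have [simp]: "P\<^sub>o (Cod E e) = Dom B f" "P\<^sub>o X = Dom B f" "X \<in> Ob E"
    using assms(1-3) by (simp_all flip: assms(4))
  show *: "on_mor (push p f) e \<cdot> cocart p f X = cocart p f (Cod E e) \<cdot> e"
    using push_mor[OF assms(1-3)] assms(4) by simp
  show "on_mor (push p f) e \<cdot> (cocart p f X \<cdot> x) = cocart p f (Cod E e) \<cdot> (e \<cdot> x)"
    if "x \<in> Mor E" "Cod E x = X"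
    using reassoc[OF *, of x] that assms by simp
qed

lemma unit_simps [simp]:
  assumes "f \<in> Mor B" "X \<in> Ob E" "P\<^sub>o X = Dom B f"
  shows "unit p f X \<in> Mor E" "Dom E (unit p f X) = X" "Cod E (unit p f X) = pull_ob f (push_ob f X)"
    "P (unit p f X) = Idm B (Dom B f)" "cart p f (push_ob f X) \<cdot> unit p f X = cocart p f X"
    "\<lbrakk>x \<in> Mor E; Cod E x = X\<rbrakk> \<Longrightarrow> cart p f (push_ob f X) \<cdot> (unit p f X \<cdot> x) = cocart p f X \<cdot> x"
proof -
  have "\<exists>!e. e \<in> Hom (fiber p (Dom B f)) X (on_ob (pull p f \<circ>\<^sub>F push p f) X)
      \<and> cart p f (push_ob f X) \<cdot> e = cocart p f X"
    using assms by (intro fiber_lift_ex1) (simp_all add: comp_funct_def)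
  from theI'[OF this] have *: "unit p f X \<in> Hom (fiber p (Dom B f)) X (pull_ob f (push_ob f X))
      \<and> cart p f (push_ob f X) \<cdot> unit p f X = cocart p f X"
    by (simp add: unit_def comp_funct_def)
  then show 1: "unit p f X \<in> Mor E" "Dom E (unit p f X) = X"
    "Cod E (unit p f X) = pull_ob f (push_ob f X)" "P (unit p f X) = Idm B (Dom B f)"
    and 2: "cart p f (push_ob f X) \<cdot> unit p f X = cocart p f X"
    by (simp_all add: Hom_fiber)
  show "\<lbrakk>x \<in> Mor E; Cod E x = X\<rbrakk> \<Longrightarrow> cart p f (push_ob f X) \<cdot> (unit p f X \<cdot> x) = cocart p f X \<cdot> x"
    using reassoc[OF 2, of x] 1 assms by simp
qed

lemma counit_simps [simp]:
  assumes "f \<in> Mor B" "Y \<in> Ob E" "P\<^sub>o Y = Cod B f"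
  shows "counit p f Y \<in> Mor E" "Dom E (counit p f Y) = push_ob f (pull_ob f Y)" "Cod E (counit p f Y) = Y"
    "P (counit p f Y) = Idm B (Cod B f)" "counit p f Y \<cdot> cocart p f (pull_ob f Y) = cart p f Y"
    "\<lbrakk>x \<in> Mor E; Cod E x = pull_ob f Y\<rbrakk> \<Longrightarrow>
      counit p f Y \<cdot> (cocart p f (pull_ob f Y) \<cdot> x) = cart p f Y \<cdot> x"
proof -
  have "\<exists>!e. e \<in> Hom (fiber p (Cod B f)) (on_ob (push p f \<circ>\<^sub>F pull p f) Y) Y
      \<and> e \<cdot> cocart p f (pull_ob f Y) = cart p f Y"
    using assms by (intro fiber_colift_ex1) (simp_all add: comp_funct_def)
  from theI'[OF this] have *: "counit p f Y \<in> Hom (fiber p (Cod B f)) (push_ob f (pull_ob f Y)) Y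
      \<and> counit p f Y \<cdot> cocart p f (pull_ob f Y) = cart p f Y"
    by (simp add: counit_def comp_funct_def)
  then show 1: "counit p f Y \<in> Mor E" "Dom E (counit p f Y) = push_ob f (pull_ob f Y)"
    "Cod E (counit p f Y) = Y" "P (counit p f Y) = Idm B (Cod B f)"
    and 2: "counit p f Y \<cdot> cocart p f (pull_ob f Y) = cart p f Y"
    by (simp_all add: Hom_fiber)
  show "\<lbrakk>x \<in> Mor E; Cod E x = pull_ob f Y\<rbrakk> \<Longrightarrow>
      counit p f Y \<cdot> (cocart p f (pull_ob f Y) \<cdot> x) = cart p f Y \<cdot> x"
    using reassoc[OF 2, of x] 1 assms by simp
qed

section \<open>Comparison of cartesian morphisms and the pseudofunctoriality isomorphisms\<close>

text \<open>Each of \<open>e\<close> and \<open>e'\<close> factors through the other by a vertical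
  morphism, and cancelling a cartesian morphism shows the two factorisations to be inverse. This
  yields the invertibility of \<open>iota\<close>, \<open>kappa\<close> and
  \<open>canon\<close>.\<close>

lemma cartesian_comparison:
  assumes e: "is_cartesian p e" and e': "is_cartesian p e'" and "Cod E e = Cod E e'" "P e = P e'"
    and j: "j \<in> Mor E" "Dom E j = Dom E e'" "Cod E j = Dom E e" "P j = Idm B (Dom B (P e))"
    and ej: "e \<cdot> j = e'"
  shows "is_iso E j" "P (inverse_of E j) = Idm B (Dom B (P e))" "e' \<cdot> inverse_of E j = e"
proof -
  have [simp]: "e \<in> Mor E" "e' \<in> Mor E" "j \<in> Mor E" using assms by auto
  obtain i where i: "i \<in> Hom (fiber p (Dom B (P e'))) (Dom E e) (Dom E e')" "e' \<cdot> i = e"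
  proof -
    have "\<exists>!v. v \<in> Hom (fiber p (Dom B (P e'))) (Dom E e) (Dom E e') \<and> e' \<cdot> v = e"
      using assms(3,4) by (intro fiber_lift_ex1[OF e']) simp_all
    then show thesis using that by blast
  qed
  then have [simp]: "i \<in> Mor E" "Dom E i = Dom E e" "Cod E i = Dom E e'" "P i = Idm B (Dom B (P e))"
    using assms(4) by (auto simp: Hom_fiber)
  have "i \<cdot> j = Idm E (Dom E j)"
    by (rule cartesian_cancel[OF e'])
      (use reassoc[OF i(2), of j] assms in \<open>simp_all add: \<open>P e = P e'\<close>\<close>)
  moreover have "j \<cdot> i = Idm E (Cod E j)"
    by (rule cartesian_cancel[OF e])
      (use reassoc[OF ej, of i] i(2) assms in \<open>simp_all add: \<open>P e = P e'\<close>\<close>)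
  ultimately have "is_inverse E j i" using j by (simp add: is_inverse_def Hom_def)
  then show "is_iso E j" "P (inverse_of E j) = Idm B (Dom B (P e))" "e' \<cdot> inverse_of E j = e"
    using i(2) by (auto simp: is_iso_def proj.C.inverse_of_eq)
qed

lemma cartesian_id [simp]:
  assumes "X \<in> Ob E"
  shows "is_cartesian p (Idm E X)"
  unfolding is_cartesian_def
proof (intro conjI allI impI)
  show "Idm E X \<in> Mor E" using assms by simp
  fix Z z u
  assume z: "z \<in> Hom E Z (Cod E (Idm E X))" and u: "u \<in> Hom B (P\<^sub>o Z) (P\<^sub>o (Dom E (Idm E X)))"
    and eq: "P (Idm E X) \<star> u = P z"
  have z: "z \<in> Mor E" "Dom E z = Z" "Cod E z = X" using z assms by (simp_all add: Hom_def)
  have "P z = u" using u eq assms by (simp add: Hom_def)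
  then show "\<exists>!v. v \<in> Hom E Z (Dom E (Idm E X)) \<and> P v = u \<and> Idm E X \<cdot> v = z"
    using z assms by (intro ex1I[of _ z]) (simp_all add: Hom_def, elim conjE, simp)
qed

text \<open>Factor in two stages: through \<open>e\<close> over \<open>P e' \<star> u\<close>, then
  through \<open>e'\<close> over \<open>u\<close>. Uniqueness cancels \<open>e\<close> first and
  \<open>e'\<close> second.\<close>

lemma cartesian_comp:
  assumes "is_cartesian p e" "is_cartesian p e'" "Cod E e' = Dom E e"
  shows "is_cartesian p (e \<cdot> e')"
  unfolding is_cartesian_def
proof (intro conjI allI impI)
  have [simp]: "e \<in> Mor E" "e' \<in> Mor E" using assms by auto
  have [simp]: "Cod B (P e') = Dom B (P e)" using proj_simps(4)[of e'] assms by simp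
  show "e \<cdot> e' \<in> Mor E" using assms by simp
  fix Z z u
  assume z: "z \<in> Hom E Z (Cod E (e \<cdot> e'))" and u: "u \<in> Hom B (P\<^sub>o Z) (P\<^sub>o (Dom E (e \<cdot> e')))"
    and eq: "P (e \<cdot> e') \<star> u = P z"
  have [simp]: "z \<in> Mor E" "Dom E z = Z" "Cod E z = Cod E e" using z assms(3) by (auto simp: Hom_def)
  have Z: "P\<^sub>o Z = Dom B (P z)" using proj_simps(3)[of z] by simp
  have [simp]: "u \<in> Mor B" "Dom B u = Dom B (P z)" "Cod B u = Dom B (P e')"
    using u assms(3) by (auto simp: Hom_def Z)
  have eq': "P e \<star> (P e' \<star> u) = P z" using eq assms(3) by simp
  obtain v where v: "v \<in> Mor E" "Dom E v = Z" "Cod E v = Dom E e" "P v = P e' \<star> u" "e \<cdot> v = z"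
    using cartesian_ex1[OF assms(1), of z "P e' \<star> u"] eq' by auto
  obtain w where w: "w \<in> Mor E" "Dom E w = Z" "Cod E w = Dom E e'" "P w = u" "e' \<cdot> w = v"
  proof -
    have "\<exists>!w. w \<in> Mor E \<and> Dom E w = Dom E v \<and> Cod E w = Dom E e' \<and> P w = u \<and> e' \<cdot> w = v"
      using v assms(3) by (intro cartesian_ex1[OF assms(2)]) simp_all
    then show thesis using that v(2) by metis
  qed
  show "\<exists>!v. v \<in> Hom E Z (Dom E (e \<cdot> e')) \<and> P v = u \<and> (e \<cdot> e') \<cdot> v = z"
  proof (rule ex1I[of _ w])
    show "w \<in> Hom E Z (Dom E (e \<cdot> e')) \<and> P w = u \<and> (e \<cdot> e') \<cdot> w = z"
      using v w assms(3) by (simp add: Hom_def)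
    fix w' assume "w' \<in> Hom E Z (Dom E (e \<cdot> e')) \<and> P w' = u \<and> (e \<cdot> e') \<cdot> w' = z"
    then have w': "w' \<in> Mor E" "Dom E w' = Z" "Cod E w' = Dom E e'" "P w' = u" "e \<cdot> (e' \<cdot> w') = z"
      using assms(3) by (auto simp: Hom_def)
    have "e' \<cdot> w' = e' \<cdot> w"
      by (rule cartesian_cancel[OF assms(1)]) (use v w w' assms(3) in simp_all)
    then show "w' = w"
      by (rule cartesian_cancel[OF assms(2)]) (use w w' in simp_all)
  qed
qed

lemma iota_simps [simp]:
  assumes "X \<in> Ob E" "P\<^sub>o X = A"
  shows "iota p A X \<in> Mor E" "Dom E (iota p A X) = X" "Cod E (iota p A X) = pull_ob (Idm B A) X"
    "P (iota p A X) = Idm B A" "cart p (Idm B A) X \<cdot> iota p A X = Idm E X" "is_iso E (iota p A X)"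
proof -
  have [simp]: "A \<in> Ob B" using assms by auto
  have "\<exists>!e. e \<in> Hom (fiber p A) X (pull_ob (Idm B A) X) \<and> cart p (Idm B A) X \<cdot> e = Idm E X"
    using assms by (intro fiber_lift_ex1) simp_all
  from theI'[OF this] have *: "iota p A X \<in> Hom (fiber p A) X (pull_ob (Idm B A) X)
      \<and> cart p (Idm B A) X \<cdot> iota p A X = Idm E X"
    by (simp add: iota_def)
  then show 1: "iota p A X \<in> Mor E" "Dom E (iota p A X) = X" "Cod E (iota p A X) = pull_ob (Idm B A) X"
    "P (iota p A X) = Idm B A" "cart p (Idm B A) X \<cdot> iota p A X = Idm E X"
    by (simp_all add: Hom_fiber)
  show "is_iso E (iota p A X)"
    by (rule cartesian_comparison[of "cart p (Idm B A) X" "Idm E X"]) (use 1 assms in simp_all)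
qed

text \<open>The lift of \<open>f \<star> g\<close> and the composite of the lifts of
  \<open>f\<close> and \<open>g\<close> are cartesian over the same morphism with the same codomain,
  and \<open>kappa\<close> is their comparison.\<close>

lemma kappa_simps [simp]:
  assumes "f \<in> Mor B" "g \<in> Mor B" "Cod B g = Dom B f" "Y \<in> Ob E" "P\<^sub>o Y = Cod B f"
  shows "kappa p f g Y \<in> Mor E" "Dom E (kappa p f g Y) = pull_ob g (pull_ob f Y)"
    "Cod E (kappa p f g Y) = pull_ob (f \<star> g) Y" "P (kappa p f g Y) = Idm B (Dom B g)"
    "is_iso E (kappa p f g Y)" "P (inverse_of E (kappa p f g Y)) = Idm B (Dom B g)"
    and kappa: "cart p (f \<star> g) Y \<cdot> kappa p f g Y = cart p f Y \<cdot> cart p g (pull_ob f Y)"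
    and inverse_kappa: "cart p f Y \<cdot> (cart p g (pull_ob f Y) \<cdot> inverse_of E (kappa p f g Y)) = cart p (f \<star> g) Y"
proof -
  have "\<exists>!e. e \<in> Hom (fiber p (Dom B g)) (on_ob (pull p g \<circ>\<^sub>F pull p f) Y) (pull_ob (f \<star> g) Y)
      \<and> cart p (f \<star> g) Y \<cdot> e = cart p f Y \<cdot> cart p g (pull_ob f Y)"
    using assms by (intro fiber_lift_ex1) (simp_all add: comp_funct_def)
  from theI'[OF this] have *: "kappa p f g Y \<in> Hom (fiber p (Dom B g)) (pull_ob g (pull_ob f Y)) (pull_ob (f \<star> g) Y)
      \<and> cart p (f \<star> g) Y \<cdot> kappa p f g Y = cart p f Y \<cdot> cart p g (pull_ob f Y)"
    by (simp add: kappa_def comp_funct_def)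
  then show 1: "kappa p f g Y \<in> Mor E" "Dom E (kappa p f g Y) = pull_ob g (pull_ob f Y)"
    "Cod E (kappa p f g Y) = pull_ob (f \<star> g) Y" "P (kappa p f g Y) = Idm B (Dom B g)"
    "cart p (f \<star> g) Y \<cdot> kappa p f g Y = cart p f Y \<cdot> cart p g (pull_ob f Y)"
    by (simp_all add: Hom_fiber)
  have cc: "is_cartesian p (cart p f Y \<cdot> cart p g (pull_ob f Y))"
    using assms by (intro cartesian_comp) simp_all
  note 2 = cartesian_comparison[OF _ cc, of "cart p (f \<star> g) Y" "kappa p f g Y"]
  show "is_iso E (kappa p f g Y)" using 2(1) 1 assms by simp
  then show "P (inverse_of E (kappa p f g Y)) = Idm B (Dom B g)"
    "cart p f Y \<cdot> (cart p g (pull_ob f Y) \<cdot> inverse_of E (kappa p f g Y)) = cart p (f \<star> g) Y"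
    using 2(2,3) 1 assms by simp_all
qed

text \<open>A factorisation through \<open>i \<cdot> e\<close> is one through \<open>e\<close>
  precomposed with the inverse of \<open>i\<close>. Components of the Beck-Chevalley transformation
  are such \<open>i\<close>, so their invertibility makes composites with them cocartesian.\<close>

lemma cocartesian_iso_comp:
  assumes e: "is_cocartesian p e" and i: "is_iso E i" "i \<in> Mor E" "Dom E i = Cod E e"
    "P i = Idm B (Cod B (P e))"
    and Pi: "P (inverse_of E i) = Idm B (Cod B (P e))"
  shows "is_cocartesian p (i \<cdot> e)"
  unfolding is_cocartesian_def
proof (intro conjI allI impI)
  have [simp]: "e \<in> Mor E" using e by simp
  note [simp] = i Pi
  show "i \<cdot> e \<in> Mor E" by simp
  fix Z z u
  assume z: "z \<in> Hom E (Dom E (i \<cdot> e)) Z" and u: "u \<in> Hom B (P\<^sub>o (Cod E (i \<cdot> e))) (P\<^sub>o Z)"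
    and eq: "u \<star> P (i \<cdot> e) = P z"
  have z [simp]: "z \<in> Mor E" "Cod E z = Z" "Dom E z = Dom E e" using z by (auto simp: Hom_def)
  have Z: "P\<^sub>o Z = Cod B (P z)" using proj_simps(4)[of z] by simp
  have [simp]: "u \<in> Mor B" "Dom B u = Cod B (P e)" "Cod B u = Cod B (P z)"
    using u by (auto simp: Hom_def Z)
  have eq': "u \<star> P e = P z" using eq by simp
  obtain v where v: "v \<in> Mor E" "Dom E v = Cod E e" "Cod E v = Z" "P v = u" "v \<cdot> e = z"
    using cocartesian_ex1[OF e, of z u] eq' by auto
  have inv: "inverse_of E i \<cdot> (i \<cdot> e) = e"
    using reassoc[OF proj.C.inverse_of_simps(4)[OF i(1)], of e] by simp
  show "\<exists>!v. v \<in> Hom E (Cod E (i \<cdot> e)) Z \<and> P v = u \<and> v \<cdot> (i \<cdot> e) = z"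
  proof (rule ex1I[of _ "v \<cdot> inverse_of E i"])
    show "v \<cdot> inverse_of E i \<in> Hom E (Cod E (i \<cdot> e)) Z \<and> P (v \<cdot> inverse_of E i) = u \<and>
        (v \<cdot> inverse_of E i) \<cdot> (i \<cdot> e) = z"
      using v inv by (simp add: Hom_def)
    fix w assume "w \<in> Hom E (Cod E (i \<cdot> e)) Z \<and> P w = u \<and> w \<cdot> (i \<cdot> e) = z"
    then have w: "w \<in> Mor E" "Dom E w = Cod E i" "Cod E w = Z" "P w = u" "w \<cdot> (i \<cdot> e) = z"
      by (auto simp: Hom_def)
    have "w \<cdot> i = v" by (rule cocartesian_cancel[OF e]) (use v w in simp_all)
    then have "(w \<cdot> i) \<cdot> inverse_of E i = v \<cdot> inverse_of E i" by simp
    then show "w = v \<cdot> inverse_of E i" using w by simp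
  qed
qed

lemma cartesian_cancel_iff:
  assumes "is_cartesian p e" "v \<in> Mor E" "w \<in> Mor E"
    "Dom E v = Dom E w" "Cod E v = Dom E e" "Cod E w = Dom E e" "P v = P w"
  shows "e \<cdot> v = e \<cdot> w \<longleftrightarrow> v = w"
  using cartesian_cancel[OF assms(1) _ assms(2-)] by blast

lemma cocartesian_cancel_iff:
  assumes "is_cocartesian p e" "v \<in> Mor E" "w \<in> Mor E"
    "Cod E v = Cod E w" "Dom E v = Cod E e" "Dom E w = Cod E e" "P v = P w"
  shows "v \<cdot> e = w \<cdot> e \<longleftrightarrow> v = w"
  using cocartesian_cancel[OF assms(1) _ assms(2-)] by blast

text \<open>Cancel \<open>e\<close> first and \<open>e'\<close> second. The associativity laws of
  algebras and of actions are tested on such composites.\<close>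

lemma cocartesian_comp_cancel_iff:
  assumes "is_cocartesian p e" "is_cocartesian p e'" "Dom E e' = Cod E e" "v \<in> Mor E" "w \<in> Mor E"
    "Cod E v = Cod E w" "Dom E v = Cod E e'" "Dom E w = Cod E e'" "P v = P w"
  shows "v \<cdot> (e' \<cdot> e) = w \<cdot> (e' \<cdot> e) \<longleftrightarrow> v = w"
proof
  have [simp]: "e \<in> Mor E" "e' \<in> Mor E" using assms by auto
  have D: "Dom B (P w) = Cod B (P e')" using proj_simps(3)[of w] assms by simp
  assume eq: "v \<cdot> (e' \<cdot> e) = w \<cdot> (e' \<cdot> e)"
  have "v \<cdot> e' = w \<cdot> e'"
    by (rule cocartesian_cancel[OF assms(1)]) (use assms eq D in simp_all)
  then show "v = w" by (rule cocartesian_cancel[OF assms(2)]) (use assms in simp_all)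
qed simp

lemma comp_funct_simps [simp]:
  "on_ob (G \<circ>\<^sub>F F) X = on_ob G (on_ob F X)" "on_mor (G \<circ>\<^sub>F F) h = on_mor G (on_mor F h)"
  by (simp_all add: comp_funct_def)

subsection \<open>Mates of canonical isomorphisms\<close>

text \<open>For \<open>f \<star> g = h \<star> k\<close> this is the canonical isomorphism from
  pulling back along \<open>h\<close> and then \<open>k\<close> to pulling back along
  \<open>f\<close> and then \<open>g\<close>. The transformations \<open>j1\<close>,
  \<open>j2\<close>, \<open>j12\<close> and the middle factor of \<open>BC\<close> all have this
  form.\<close>

definition canon where
  "canon f g h k = inv_trans p (kappa p f g) \<odot>\<^bsub>p\<^esub> kappa p h k"

lemma canon_simps [simp]:
  assumes "f \<in> Mor B" "g \<in> Mor B" "Cod B g = Dom B f" "h \<in> Mor B" "k \<in> Mor B" "Cod B k = Dom B h"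
    "f \<star> g = h \<star> k" "Y \<in> Ob E" "P\<^sub>o Y = Cod B f"
  shows "canon f g h k Y \<in> Mor E" "Dom E (canon f g h k Y) = pull_ob k (pull_ob h Y)"
    "Cod E (canon f g h k Y) = pull_ob g (pull_ob f Y)" "P (canon f g h k Y) = Idm B (Dom B g)"
    and cart_canon: "cart p f Y \<cdot> (cart p g (pull_ob f Y) \<cdot> canon f g h k Y) =
      cart p h Y \<cdot> cart p k (pull_ob h Y)"
    and cart_canon_comp: "\<lbrakk>x \<in> Mor E; Cod E x = pull_ob k (pull_ob h Y)\<rbrakk> \<Longrightarrow>
      cart p f Y \<cdot> (cart p g (pull_ob f Y) \<cdot> (canon f g h k Y \<cdot> x)) =
      cart p h Y \<cdot> (cart p k (pull_ob h Y) \<cdot> x)"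
    and canon_iso: "is_iso E (canon f g h k Y)"
    and proj_inverse_canon: "P (inverse_of E (canon f g h k Y)) = Idm B (Dom B g)"
    and cart_inverse_canon: "cart p h Y \<cdot> (cart p k (pull_ob h Y) \<cdot> inverse_of E (canon f g h k Y)) =
      cart p f Y \<cdot> cart p g (pull_ob f Y)"
proof -
  have dc [simp]: "Dom B g = Dom B k" "Cod B f = Cod B h"
    using arg_cong[OF assms(7), of "Dom B"] arg_cong[OF assms(7), of "Cod B"] assms(1-6) by simp_all
  have Y: "P\<^sub>o Y = Cod B h" using assms(9) by simp
  have eq: "canon f g h k Y = inverse_of E (kappa p f g Y) \<cdot> kappa p h k Y"
    by (simp add: canon_def vcomp_def inv_trans_def)
  have k: "Cod E (kappa p h k Y) = pull_ob (f \<star> g) Y" "cart p (f \<star> g) Y \<cdot> kappa p h k Y =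
      cart p h Y \<cdot> cart p k (pull_ob h Y)" "P\<^sub>o (pull_ob (f \<star> g) Y) = Dom B k"
    using assms kappa[of h k Y] Y by simp_all
  show 1: "canon f g h k Y \<in> Mor E" "Dom E (canon f g h k Y) = pull_ob k (pull_ob h Y)"
    "Cod E (canon f g h k Y) = pull_ob g (pull_ob f Y)" "P (canon f g h k Y) = Idm B (Dom B g)"
    using assms k Y unfolding eq by simp_all
  have ik: "(cart p f Y \<cdot> cart p g (pull_ob f Y)) \<cdot> inverse_of E (kappa p f g Y) = cart p (f \<star> g) Y"
    using inverse_kappa[of f g Y] assms Y by simp
  have 2: "(cart p f Y \<cdot> cart p g (pull_ob f Y)) \<cdot> canon f g h k Y = cart p h Y \<cdot> cart p k (pull_ob h Y)"
    unfolding eq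
    by (subst reassoc[OF ik]) (use assms k Y in simp_all)
  then show "cart p f Y \<cdot> (cart p g (pull_ob f Y) \<cdot> canon f g h k Y) =
      cart p h Y \<cdot> cart p k (pull_ob h Y)"
    using 1 assms Y by simp
  show "cart p f Y \<cdot> (cart p g (pull_ob f Y) \<cdot> (canon f g h k Y \<cdot> x)) =
      cart p h Y \<cdot> (cart p k (pull_ob h Y) \<cdot> x)"
    if "x \<in> Mor E" "Cod E x = pull_ob k (pull_ob h Y)"
    using reassoc[OF 2, of x] that 1 assms(1-6,8) Y by simp
  have cc: "is_cartesian p (cart p f Y \<cdot> cart p g (pull_ob f Y))"
    "is_cartesian p (cart p h Y \<cdot> cart p k (pull_ob h Y))"
    using assms Y by (auto intro!: cartesian_comp)
  note cmp = cartesian_comparison[OF cc, of "canon f g h k Y"]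
  show "is_iso E (canon f g h k Y)" using cmp(1) 1 2 assms Y by simp
  then show "P (inverse_of E (canon f g h k Y)) = Idm B (Dom B g)"
    "cart p h Y \<cdot> (cart p k (pull_ob h Y) \<cdot> inverse_of E (canon f g h k Y)) =
      cart p f Y \<cdot> cart p g (pull_ob f Y)"
    using cmp(2,3) 1 2 assms Y by simp_all
qed

text \<open>Between the cocartesian lift of \<open>k\<close> and the cartesian lift of
  \<open>h\<close>, the counit becomes the cartesian lift of \<open>k\<close>, \<open>canon\<close>
  exchanges the two pairs of cartesian lifts, and the unit becomes the cocartesian lift of
  \<open>f\<close>. The mate is thus described by lifts alone.\<close>

lemma mate_canon [simp]:
  assumes "f \<in> Mor B" "g \<in> Mor B" "Cod B g = Dom B f" "h \<in> Mor B" "k \<in> Mor B" "Cod B k = Dom B h"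
    "h \<star> k = f \<star> g" "W \<in> Ob E" "P\<^sub>o W = Dom B f"
  defines "m \<equiv> mate p g f k h (canon h k f g) W"
  shows "m \<in> Mor E" "Dom E m = push_ob k (pull_ob g W)" "Cod E m = pull_ob h (push_ob f W)"
    "P m = Idm B (Dom B h)"
    and cart_mate: "cart p h (push_ob f W) \<cdot> (m \<cdot> cocart p k (pull_ob g W)) = cocart p f W \<cdot> cart p g W"
    and cart_mate_comp: "\<lbrakk>x \<in> Mor E; Cod E x = pull_ob g W\<rbrakk> \<Longrightarrow>
      cart p h (push_ob f W) \<cdot> (m \<cdot> (cocart p k (pull_ob g W) \<cdot> x)) = cocart p f W \<cdot> (cart p g W \<cdot> x)"
proof -
  have [simp]: "Dom B k = Dom B g" "Cod B f = Cod B h"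
    using arg_cong[OF assms(7), of "Dom B"] arg_cong[OF assms(7), of "Cod B"] assms(1-6) by simp_all
  note [simp] = assms(1-9)
  have m: "m = counit p k (pull_ob h (push_ob f W)) \<cdot> (on_mor (push p k) (canon h k f g (push_ob f W))
      \<cdot> on_mor (push p k) (on_mor (pull p g) (unit p f W)))"
    by (simp add: m_def mate_def vcomp_def whisker_left_def whisker_right_def)
  show 1: "m \<in> Mor E" "Dom E m = push_ob k (pull_ob g W)" "Cod E m = pull_ob h (push_ob f W)"
    "P m = Idm B (Dom B h)"
    unfolding m by simp_all
  show "cart p h (push_ob f W) \<cdot> (m \<cdot> cocart p k (pull_ob g W)) = cocart p f W \<cdot> cart p g W"
    unfolding m by simp
  show "cart p h (push_ob f W) \<cdot> (m \<cdot> (cocart p k (pull_ob g W) \<cdot> x)) = cocart p f W \<cdot> (cart p g W \<cdot> x)"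
    if "x \<in> Mor E" "Cod E x = pull_ob g W"
    unfolding m using that by simp
qed

text \<open>The outer counit and unit are absorbed as in \<open>mate_canon\<close>, whose equation
  handles the inner mate. The result is the vertical comparison of the two cocartesian composites
  over \<open>h \<star> k = f \<star> g\<close>.\<close>

lemma twofold_mate_canon:
  assumes "f \<in> Mor B" "g \<in> Mor B" "Cod B g = Dom B f" "h \<in> Mor B" "k \<in> Mor B" "Cod B k = Dom B h"
    "h \<star> k = f \<star> g" "W \<in> Ob E" "P\<^sub>o W = Dom B g"
  defines "m \<equiv> twofold_mate p g f k h (canon h k f g) W"
  shows "m \<in> Mor E" "Dom E m = push_ob h (push_ob k W)" "Cod E m = push_ob f (push_ob g W)"
    "P m = Idm B (Cod B h)"
    "m \<cdot> (cocart p h (push_ob k W) \<cdot> cocart p k W) = cocart p f (push_ob g W) \<cdot> cocart p g W"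
proof -
  have [simp]: "Dom B k = Dom B g" "Cod B f = Cod B h"
    using arg_cong[OF assms(7), of "Dom B"] arg_cong[OF assms(7), of "Cod B"] assms(1-6) by simp_all
  note [simp] = assms(1-9)
  have m: "m = counit p h (push_ob f (push_ob g W))
      \<cdot> (on_mor (push p h) (mate p g f k h (canon h k f g) (push_ob g W))
      \<cdot> on_mor (push p h) (on_mor (push p k) (unit p g W)))"
    by (simp add: m_def twofold_mate_def vcomp_def whisker_left_def whisker_right_def)
  show "m \<in> Mor E" "Dom E m = push_ob h (push_ob k W)" "Cod E m = push_ob f (push_ob g W)"
    "P m = Idm B (Cod B h)"
    "m \<cdot> (cocart p h (push_ob k W) \<cdot> cocart p k W) = cocart p f (push_ob g W) \<cdot> cocart p g W"
    unfolding m by simp_all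
qed

subsection \<open>The Beck--Chevalley condition\<close>

lemma BC_eq_mate: "BC p a c b d = mate p a d c b (canon b c d a)"
  by (simp add: BC_def mate_def canon_def)

lemma pullback_squareD:
  assumes "pullback_square B a c b d"
  shows "a \<in> Mor B" "c \<in> Mor B" "b \<in> Mor B" "d \<in> Mor B" "Dom B c = Dom B a" "Cod B a = Dom B d"
    "Cod B c = Dom B b" "Cod B d = Cod B b" "d \<star> a = b \<star> c"
  using assms by (simp_all add: pullback_square_def Hom_def)

lemma pullback_square_ex1:
  assumes "pullback_square B a c b d" "u \<in> Mor B" "v \<in> Mor B" "Dom B u = Z" "Dom B v = Z"
    "Cod B u = Dom B d" "Cod B v = Dom B b" "d \<star> u = b \<star> v"
  shows "\<exists>!h. h \<in> Hom B Z (Dom B a) \<and> a \<star> h = u \<and> c \<star> h = v"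
proof -
  have "u \<in> Hom B Z (Dom B d)" "v \<in> Hom B Z (Dom B b)" using assms by (simp_all add: Hom_def)
  then show ?thesis using assms(1,8) unfolding pullback_square_def by blast
qed

text \<open>The Beck-Chevalley condition speaks of inverses in a fiber, whereas
  \<open>inv_trans\<close> takes them in the total category. This lemma and
  \<open>proj_inverse\<close> connect the two.\<close>

lemma is_iso_total: "is_iso (fiber p A) e \<Longrightarrow> is_iso E e"
  by (auto simp: is_iso_def is_inverse_def Hom_fiber Hom_def)

lemma proj_inverse:
  assumes "is_iso (fiber p A) e"
  shows "P (inverse_of E e) = Idm B A"
proof -
  obtain g where "is_inverse (fiber p A) e g" using assms by (auto simp: is_iso_def)
  then have "is_inverse E e g" "P g = Idm B A" by (simp_all add: is_inverse_def Hom_fiber Hom_def)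
  then show ?thesis by (simp add: proj.C.inverse_of_eq)
qed

lemma BC_iso:
  assumes "beck_chevalley p" "pullback_square B a c b d" "X \<in> Ob E" "P\<^sub>o X = Dom B d"
  shows "is_iso (fiber p (Dom B b)) (BC p a c b d X)"
proof -
  interpret natural_isomorphism "fiber p (Dom B d)" "fiber p (Dom B b)"
    "push p c \<circ>\<^sub>F pull p a" "pull p b \<circ>\<^sub>F push p d" "BC p a c b d"
    using assms(1,2) by (simp add: beck_chevalley_def)
  show ?thesis using component_iso assms(3,4) by simp
qed

text \<open>The Beck-Chevalley condition as a statement about squares in the total category: the
  sides over \<open>a\<close> and \<open>b\<close> are cartesian, and cocartesianness passes from
  the side over \<open>d\<close> to the side over \<open>c\<close>. For the chosen lift over
  \<open>d\<close>, the side over \<open>c\<close> is a Beck-Chevalley component after a chosen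
  lift; a general \<open>e\<close> differs from the chosen one by a vertical isomorphism.\<close>

lemma cocartesian_over_pullback:
  assumes bc: "beck_chevalley p" and sq: "pullback_square B a c b d"
    and X: "X \<in> Ob E" "P\<^sub>o X = Dom B d"
    and e: "is_cocartesian p e" "Dom E e = X" "P e = d"
    and t: "t \<in> Mor E" "Dom E t = pull_ob a X" "Cod E t = pull_ob b (Cod E e)" "P t = c"
    and eq: "cart p b (Cod E e) \<cdot> t = e \<cdot> cart p a X"
  shows "is_cocartesian p t"
proof -
  note [simp] = pullback_squareD(1-8)[OF sq] pullback_squareD(9)[OF sq, symmetric]
  note [simp] = X e t
  have [simp]: "e \<in> Mor E" using e(1) by simp
  have iso: "is_iso (fiber p (Dom B b)) (BC p a c b d X)" using bc sq X by (rule BC_iso)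
  note [simp] = is_iso_total[OF iso] proj_inverse[OF iso]
  have BC: "BC p a c b d X \<in> Mor E" "Dom E (BC p a c b d X) = push_ob c (pull_ob a X)"
    "Cod E (BC p a c b d X) = pull_ob b (push_ob d X)" "P (BC p a c b d X) = Idm B (Dom B b)"
    "cart p b (push_ob d X) \<cdot> (BC p a c b d X \<cdot> cocart p c (pull_ob a X)) = cocart p d X \<cdot> cart p a X"
    unfolding BC_eq_mate by simp_all
  have t0: "is_cocartesian p (BC p a c b d X \<cdot> cocart p c (pull_ob a X))"
    by (rule cocartesian_iso_comp) (simp_all add: BC)
  \<comment> \<open>The cocartesian morphisms \<open>e\<close> and \<open>cocart p d X\<close>
    factor through each other, which gives mutually inverse vertical \<open>i\<close> and
    \<open>j\<close>; applying \<open>pull p b\<close> keeps them inverse.\<close>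
  have "\<exists>!i. i \<in> Hom (fiber p (Cod B d)) (push_ob d X) (Cod E e) \<and> i \<cdot> cocart p d X = e"
    by (rule fiber_colift_ex1) simp_all
  then obtain i where i: "i \<in> Mor E" "Dom E i = push_ob d X" "Cod E i = Cod E e"
    "P i = Idm B (Cod B b)" "i \<cdot> cocart p d X = e"
    by (auto simp: Hom_fiber)
  have "\<exists>!j. j \<in> Hom (fiber p (Cod B d)) (Cod E e) (push_ob d X) \<and> j \<cdot> e = cocart p d X"
    by (rule fiber_colift_ex1) simp_all
  then obtain j where j: "j \<in> Mor E" "Dom E j = Cod E e" "Cod E j = push_ob d X"
    "P j = Idm B (Cod B b)" "j \<cdot> e = cocart p d X"
    by (auto simp: Hom_fiber)
  have ij: "i \<cdot> j = Idm E (Cod E e)"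
    by (rule cocartesian_cancel[OF e(1)]) (simp_all add: i j)
  have ji: "j \<cdot> i = Idm E (push_ob d X)"
    by (rule cocartesian_cancel[of "cocart p d X"]) (simp_all add: i j)
  have [simp]: "P\<^sub>o (Cod E e) = Cod B b" by simp
  have "on_mor (pull p b) i \<cdot> on_mor (pull p b) j = Idm E (pull_ob b (Cod E e))"
    by (rule cartesian_cancel[of "cart p b (Cod E e)"])
      (use reassoc[OF ij, of "cart p b (Cod E e)"] in \<open>simp_all add: i j\<close>)
  moreover have "on_mor (pull p b) j \<cdot> on_mor (pull p b) i = Idm E (pull_ob b (push_ob d X))"
    by (rule cartesian_cancel[of "cart p b (push_ob d X)"])
      (use reassoc[OF ji, of "cart p b (push_ob d X)"] in \<open>simp_all add: i j\<close>)
  ultimately have inv: "is_inverse E (on_mor (pull p b) i) (on_mor (pull p b) j)"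
    by (simp add: is_inverse_def Hom_def i j)
  then have pb_iso: "is_iso E (on_mor (pull p b) i)" "inverse_of E (on_mor (pull p b) i) = on_mor (pull p b) j"
    by (auto simp: is_iso_def proj.C.inverse_of_eq)
  \<comment> \<open>After the cartesian lift of \<open>b\<close> both sides equal
    \<open>e \<cdot> cart p a X\<close>.\<close>
  have "t = on_mor (pull p b) i \<cdot> (BC p a c b d X \<cdot> cocart p c (pull_ob a X))"
    by (rule cartesian_cancel[of "cart p b (Cod E e)"])
      (use reassoc[OF i(5), of "cart p a X"] eq in \<open>simp_all add: i BC\<close>)
  moreover have "is_cocartesian p (on_mor (pull p b) i \<cdot> (BC p a c b d X \<cdot> cocart p c (pull_ob a X)))"
    by (rule cocartesian_iso_comp[OF t0]) (simp_all add: i j BC pb_iso)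
  ultimately show ?thesis by simp
qed

text \<open>For a section \<open>s\<close> of \<open>g\<close>, the composite of the lifts of
  \<open>g\<close> and \<open>s\<close> is vertical and cartesian, so \<open>d\<close> compares it
  with the identity and has this composite as its inverse. The instances are \<open>d1\<close> and
  \<open>d2\<close>.\<close>

lemma section_canon:
  assumes [simp]: "g \<in> Mor B" "s \<in> Mor B" "Cod B s = Dom B g" "Dom B s = A" "Cod B g = A"
    "g \<star> s = Idm B A" "Y \<in> Ob E" "P\<^sub>o Y = A"
  defines "d \<equiv> (inv_trans p (kappa p g s) \<odot>\<^bsub>p\<^esub> iota p A) Y"
  shows "d \<in> Mor E" "Dom E d = Y" "Cod E d = pull_ob s (pull_ob g Y)" "P d = Idm B A"
    "cart p g Y \<cdot> (cart p s (pull_ob g Y) \<cdot> d) = Idm E Y"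
    "inverse_of E d = cart p g Y \<cdot> cart p s (pull_ob g Y)"
proof -
  have [simp]: "A \<in> Ob B" using assms(7,8) by (metis proj_simps(1))
  have d: "d = inverse_of E (kappa p g s Y) \<cdot> iota p A Y"
    by (simp add: d_def vcomp_def inv_trans_def)
  have k [simp]: "Cod E (kappa p g s Y) = pull_ob (Idm B A) Y"
    using kappa_simps(3)[of g s Y] by simp
  show 1: "d \<in> Mor E" "Dom E d = Y" "Cod E d = pull_ob s (pull_ob g Y)" "P d = Idm B A"
    unfolding d by simp_all
  have ik: "(cart p g Y \<cdot> cart p s (pull_ob g Y)) \<cdot> inverse_of E (kappa p g s Y) = cart p (Idm B A) Y"
    using inverse_kappa[of g s Y] by simp
  have 2: "(cart p g Y \<cdot> cart p s (pull_ob g Y)) \<cdot> d = Idm E Y"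
    unfolding d by (subst reassoc[OF ik]) simp_all
  then show "cart p g Y \<cdot> (cart p s (pull_ob g Y) \<cdot> d) = Idm E Y"
    using 1 by simp
  have cc: "is_cartesian p (cart p g Y \<cdot> cart p s (pull_ob g Y))" by (intro cartesian_comp) simp_all
  have "is_iso E d" "Idm E Y \<cdot> inverse_of E d = cart p g Y \<cdot> cart p s (pull_ob g Y)"
    using cartesian_comparison(1,3)[OF cc, of "Idm E Y" d] 1 2 by simp_all
  then show "inverse_of E d = cart p g Y \<cdot> cart p s (pull_ob g Y)"
    using 1 by simp
qed

end

section \<open>The kernel pair\<close>

text \<open>A generalised point of the domain of \<open>\<pi>\<^sub>2\<close> is a composable pair
  of arrows: \<open>\<pi>\<^sub>2\<close> gives the arrow taken first and
  \<open>\<pi>\<^sub>1\<close> the second, since the target of the former is the source of the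
  latter.\<close>

locale kernel_pair_bifibration = cloven_bifibration p
  for p :: "('co, 'cm, 'eo, 'em) bifib" +
  fixes f f\<^sub>1 f\<^sub>2 \<pi>\<^sub>1 \<pi>\<^sub>2 :: 'cm
  assumes bc: "beck_chevalley p"
    and kernel: "pullback_square (base p) f\<^sub>1 f\<^sub>2 f f"
    and comp_square: "pullback_square (base p) \<pi>\<^sub>2 \<pi>\<^sub>1 f\<^sub>1 f\<^sub>2"
begin

section \<open>The internal category of the kernel pair in the base\<close>

definition "K = Eq B f\<^sub>1 f\<^sub>2 \<pi>\<^sub>1 \<pi>\<^sub>2"
definition "\<Delta> = idn K"
definition "\<pi> = cmp K"

lemma K_simps [simp]: "src K = f\<^sub>1" "tgt K = f\<^sub>2" "idn K = \<Delta>" "cmp K = \<pi>" "pr1 K = \<pi>\<^sub>1" "pr2 K = \<pi>\<^sub>2"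
  by (simp_all add: K_def Eq_def \<Delta>_def \<pi>_def)

lemma base_simps [simp]:
  "f \<in> Mor B" "f\<^sub>1 \<in> Mor B" "f\<^sub>2 \<in> Mor B" "\<pi>\<^sub>1 \<in> Mor B" "\<pi>\<^sub>2 \<in> Mor B"
  "Cod B f\<^sub>1 = Dom B f" "Cod B f\<^sub>2 = Dom B f" "Dom B f\<^sub>2 = Dom B f\<^sub>1"
  "Cod B \<pi>\<^sub>1 = Dom B f\<^sub>1" "Cod B \<pi>\<^sub>2 = Dom B f\<^sub>1" "Dom B \<pi>\<^sub>1 = Dom B \<pi>\<^sub>2"
  "f \<star> f\<^sub>2 = f \<star> f\<^sub>1" "f\<^sub>2 \<star> \<pi>\<^sub>2 = f\<^sub>1 \<star> \<pi>\<^sub>1"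
  using pullback_squareD[OF kernel] pullback_squareD[OF comp_square] by simp_all

lemma base_comp_simps [simp]:
  assumes [simp]: "x \<in> Mor B"
  shows "Cod B x = Dom B f\<^sub>1 \<Longrightarrow> f \<star> (f\<^sub>2 \<star> x) = f \<star> (f\<^sub>1 \<star> x)"
    "Cod B x = Dom B \<pi>\<^sub>2 \<Longrightarrow> f\<^sub>2 \<star> (\<pi>\<^sub>2 \<star> x) = f\<^sub>1 \<star> (\<pi>\<^sub>1 \<star> x)"
proof -
  assume "Cod B x = Dom B f\<^sub>1"
  then show "f \<star> (f\<^sub>2 \<star> x) = f \<star> (f\<^sub>1 \<star> x)"
    using proj.D.assoc[of x f\<^sub>2 f] proj.D.assoc[of x f\<^sub>1 f] by simp
next
  assume "Cod B x = Dom B \<pi>\<^sub>2"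
  then show "f\<^sub>2 \<star> (\<pi>\<^sub>2 \<star> x) = f\<^sub>1 \<star> (\<pi>\<^sub>1 \<star> x)"
    using proj.D.assoc[of x \<pi>\<^sub>2 f\<^sub>2] proj.D.assoc[of x \<pi>\<^sub>1 f\<^sub>1] by simp
qed

lemma \<Delta>_simps [simp]:
  "\<Delta> \<in> Mor B" "Dom B \<Delta> = Dom B f" "Cod B \<Delta> = Dom B f\<^sub>1"
  "f\<^sub>1 \<star> \<Delta> = Idm B (Dom B f)" "f\<^sub>2 \<star> \<Delta> = Idm B (Dom B f)"
proof -
  have "\<exists>!h. h \<in> Hom B (Dom B f) (Dom B f\<^sub>1) \<and> f\<^sub>1 \<star> h = Idm B (Dom B f) \<and> f\<^sub>2 \<star> h = Idm B (Dom B f)"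
    by (rule pullback_square_ex1[OF kernel]) simp_all
  from theI'[OF this] show "\<Delta> \<in> Mor B" "Dom B \<Delta> = Dom B f" "Cod B \<Delta> = Dom B f\<^sub>1"
    "f\<^sub>1 \<star> \<Delta> = Idm B (Dom B f)" "f\<^sub>2 \<star> \<Delta> = Idm B (Dom B f)"
    by (simp_all add: \<Delta>_def K_def Eq_def Hom_def)
qed

lemma \<pi>_simps [simp]:
  "\<pi> \<in> Mor B" "Dom B \<pi> = Dom B \<pi>\<^sub>2" "Cod B \<pi> = Dom B f\<^sub>1" "f\<^sub>1 \<star> \<pi> = f\<^sub>1 \<star> \<pi>\<^sub>2" "f\<^sub>2 \<star> \<pi> = f\<^sub>2 \<star> \<pi>\<^sub>1"
proof -
  have "f \<star> (f\<^sub>1 \<star> \<pi>\<^sub>2) = f \<star> (f\<^sub>2 \<star> \<pi>\<^sub>2)" by (rule base_comp_simps(1)[symmetric]) simp_all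
  also have "\<dots> = f \<star> (f\<^sub>2 \<star> \<pi>\<^sub>1)" by simp
  finally have "\<exists>!h. h \<in> Hom B (Dom B \<pi>\<^sub>2) (Dom B f\<^sub>1) \<and> f\<^sub>1 \<star> h = f\<^sub>1 \<star> \<pi>\<^sub>2 \<and> f\<^sub>2 \<star> h = f\<^sub>2 \<star> \<pi>\<^sub>1"
    by (intro pullback_square_ex1[OF kernel]) simp_all
  from theI'[OF this] show "\<pi> \<in> Mor B" "Dom B \<pi> = Dom B \<pi>\<^sub>2" "Cod B \<pi> = Dom B f\<^sub>1"
    "f\<^sub>1 \<star> \<pi> = f\<^sub>1 \<star> \<pi>\<^sub>2" "f\<^sub>2 \<star> \<pi> = f\<^sub>2 \<star> \<pi>\<^sub>1"
    by (simp_all add: \<pi>_def K_def Eq_def Hom_def)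
qed

text \<open>Uniqueness in the pullback property; it recognises an arrow of the kernel pair by its
  source and target.\<close>

lemma kernel_cancel:
  assumes "f\<^sub>1 \<star> h = f\<^sub>1 \<star> k" "f\<^sub>2 \<star> h = f\<^sub>2 \<star> k" "h \<in> Mor B" "k \<in> Mor B" "Dom B h = Dom B k"
    "Cod B h = Dom B f\<^sub>1" "Cod B k = Dom B f\<^sub>1"
  shows "h = k"
proof -
  have "\<exists>!l. l \<in> Hom B (Dom B k) (Dom B f\<^sub>1) \<and> f\<^sub>1 \<star> l = f\<^sub>1 \<star> k \<and> f\<^sub>2 \<star> l = f\<^sub>2 \<star> k"
    using assms by (intro pullback_square_ex1[OF kernel]) simp_all
  then show ?thesis using assms by (auto simp: Hom_def)
qed

subsection \<open>Actions as morphisms over the target projection\<close>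

text \<open>An element of \<open>pull_ob f\<^sub>1 X\<close> may be read as an arrow of the kernel
  pair with an element of \<open>X\<close> at its source. Then \<open>diag_lift\<close> attaches the
  identity arrow, \<open>comp_lift\<close> replaces a composable pair of arrows by its composite,
  and \<open>step_lift\<close> acts with the first arrow and keeps the second.\<close>

definition diag_lift where
  "diag_lift X = lift (cart p f\<^sub>1 X) (Idm E X) \<Delta>"

definition comp_lift where
  "comp_lift X = lift (cart p f\<^sub>1 X) (cart p f\<^sub>1 X \<cdot> cart p \<pi>\<^sub>2 (pull_ob f\<^sub>1 X)) \<pi>"

definition step_lift where
  "step_lift X u = lift (cart p f\<^sub>1 X) (u \<cdot> cart p \<pi>\<^sub>2 (pull_ob f\<^sub>1 X)) \<pi>\<^sub>1"

definition premor where
  "premor X u \<longleftrightarrow> X \<in> Ob E \<and> P\<^sub>o X = Dom B f \<and> u \<in> Mor E \<and> Dom E u = pull_ob f\<^sub>1 X \<and> Cod E u = X \<and> P u = f\<^sub>2"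

text \<open>The unit and associativity laws of an action of the internal category, expressed with
  cartesian lifts only, so that algebras, descent data and actions can all be translated into
  them.\<close>

definition lawful where
  "lawful X u \<longleftrightarrow> u \<cdot> diag_lift X = Idm E X \<and> u \<cdot> step_lift X u = u \<cdot> comp_lift X"

definition "action_objects = {(X, u). premor X u \<and> lawful X u}"

definition action_mor where
  "action_mor = (\<lambda>(X, u) (Y, v) h. h \<cdot> u = v \<cdot> on_mor (pull p f\<^sub>1) h)"

lemma diag_lift_simps [simp]:
  assumes "X \<in> Ob E" "P\<^sub>o X = Dom B f"
  shows "diag_lift X \<in> Mor E" "Dom E (diag_lift X) = X" "Cod E (diag_lift X) = pull_ob f\<^sub>1 X"
    "P (diag_lift X) = \<Delta>" "cart p f\<^sub>1 X \<cdot> diag_lift X = Idm E X"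
    "\<lbrakk>x \<in> Mor E; Cod E x = X\<rbrakk> \<Longrightarrow> cart p f\<^sub>1 X \<cdot> (diag_lift X \<cdot> x) = x"
proof -
  show 1: "diag_lift X \<in> Mor E" "Dom E (diag_lift X) = X" "Cod E (diag_lift X) = pull_ob f\<^sub>1 X"
    "P (diag_lift X) = \<Delta>" and 2: "cart p f\<^sub>1 X \<cdot> diag_lift X = Idm E X"
    unfolding diag_lift_def using assms by simp_all
  show "\<lbrakk>x \<in> Mor E; Cod E x = X\<rbrakk> \<Longrightarrow> cart p f\<^sub>1 X \<cdot> (diag_lift X \<cdot> x) = x"
    using reassoc[OF 2, of x] 1 assms by simp
qed

lemma comp_lift_simps [simp]:
  assumes "X \<in> Ob E" "P\<^sub>o X = Dom B f"
  shows "comp_lift X \<in> Mor E" "Dom E (comp_lift X) = pull_ob \<pi>\<^sub>2 (pull_ob f\<^sub>1 X)"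
    "Cod E (comp_lift X) = pull_ob f\<^sub>1 X" "P (comp_lift X) = \<pi>"
    "cart p f\<^sub>1 X \<cdot> comp_lift X = cart p f\<^sub>1 X \<cdot> cart p \<pi>\<^sub>2 (pull_ob f\<^sub>1 X)"
    "\<lbrakk>x \<in> Mor E; Cod E x = pull_ob \<pi>\<^sub>2 (pull_ob f\<^sub>1 X)\<rbrakk> \<Longrightarrow>
      cart p f\<^sub>1 X \<cdot> (comp_lift X \<cdot> x) = cart p f\<^sub>1 X \<cdot> (cart p \<pi>\<^sub>2 (pull_ob f\<^sub>1 X) \<cdot> x)"
proof -
  show 1: "comp_lift X \<in> Mor E" "Dom E (comp_lift X) = pull_ob \<pi>\<^sub>2 (pull_ob f\<^sub>1 X)"
    "Cod E (comp_lift X) = pull_ob f\<^sub>1 X" "P (comp_lift X) = \<pi>"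
    and 2: "cart p f\<^sub>1 X \<cdot> comp_lift X = cart p f\<^sub>1 X \<cdot> cart p \<pi>\<^sub>2 (pull_ob f\<^sub>1 X)"
    unfolding comp_lift_def using assms by simp_all
  show "\<lbrakk>x \<in> Mor E; Cod E x = pull_ob \<pi>\<^sub>2 (pull_ob f\<^sub>1 X)\<rbrakk> \<Longrightarrow>
      cart p f\<^sub>1 X \<cdot> (comp_lift X \<cdot> x) = cart p f\<^sub>1 X \<cdot> (cart p \<pi>\<^sub>2 (pull_ob f\<^sub>1 X) \<cdot> x)"
    using reassoc[OF 2, of x] 1 assms by simp
qed

lemma premor_simps:
  assumes "premor X u"
  shows "X \<in> Ob E" "P\<^sub>o X = Dom B f" "u \<in> Mor E" "Dom E u = pull_ob f\<^sub>1 X" "Cod E u = X" "P u = f\<^sub>2"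
  using assms by (simp_all add: premor_def)

lemma step_lift_simps:
  assumes "premor X u"
  shows "step_lift X u \<in> Mor E" "Dom E (step_lift X u) = pull_ob \<pi>\<^sub>2 (pull_ob f\<^sub>1 X)"
    "Cod E (step_lift X u) = pull_ob f\<^sub>1 X" "P (step_lift X u) = \<pi>\<^sub>1"
    "cart p f\<^sub>1 X \<cdot> step_lift X u = u \<cdot> cart p \<pi>\<^sub>2 (pull_ob f\<^sub>1 X)"
    "\<lbrakk>x \<in> Mor E; Cod E x = pull_ob \<pi>\<^sub>2 (pull_ob f\<^sub>1 X)\<rbrakk> \<Longrightarrow>
      cart p f\<^sub>1 X \<cdot> (step_lift X u \<cdot> x) = u \<cdot> (cart p \<pi>\<^sub>2 (pull_ob f\<^sub>1 X) \<cdot> x)"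
proof -
  note [simp] = premor_simps[OF assms]
  show 1: "step_lift X u \<in> Mor E" "Dom E (step_lift X u) = pull_ob \<pi>\<^sub>2 (pull_ob f\<^sub>1 X)"
    "Cod E (step_lift X u) = pull_ob f\<^sub>1 X" "P (step_lift X u) = \<pi>\<^sub>1"
    and 2: "cart p f\<^sub>1 X \<cdot> step_lift X u = u \<cdot> cart p \<pi>\<^sub>2 (pull_ob f\<^sub>1 X)"
    unfolding step_lift_def by simp_all
  show "\<lbrakk>x \<in> Mor E; Cod E x = pull_ob \<pi>\<^sub>2 (pull_ob f\<^sub>1 X)\<rbrakk> \<Longrightarrow>
      cart p f\<^sub>1 X \<cdot> (step_lift X u \<cdot> x) = u \<cdot> (cart p \<pi>\<^sub>2 (pull_ob f\<^sub>1 X) \<cdot> x)"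
    using reassoc[OF 2, of x] 1 by simp
qed

lemma cart_cancel:
  assumes "cart p g X \<cdot> v = cart p g X \<cdot> w" "g \<in> Mor B" "X \<in> Ob E" "P\<^sub>o X = Cod B g"
    "v \<in> Mor E" "w \<in> Mor E" "Dom E v = Dom E w" "Cod E v = pull_ob g X" "Cod E w = pull_ob g X" "P v = P w"
  shows "v = w"
  by (rule cartesian_cancel[of "cart p g X"]) (use assms in simp_all)

lemma pull_id:
  assumes [simp]: "g \<in> Mor B" "X \<in> Ob E" "P\<^sub>o X = Cod B g"
  shows "on_mor (pull p g) (Idm E X) = Idm E (pull_ob g X)"
  by (rule cart_cancel[of g X]) simp_all

lemma pull_comp:
  assumes [simp]: "g \<in> Mor B" "h \<in> Mor E" "k \<in> Mor E" "Cod E h = Dom E k"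
    "P h = Idm B (Cod B g)" "P k = Idm B (Cod B g)"
  shows "on_mor (pull p g) (k \<cdot> h) = on_mor (pull p g) k \<cdot> on_mor (pull p g) h"
proof -
  have [simp]: "P\<^sub>o (Cod E k) = Cod B g" "P\<^sub>o (Dom E k) = Cod B g" "P\<^sub>o (Dom E h) = Cod B g"
    by simp_all
  show ?thesis by (rule cart_cancel[of g "Cod E k"]) simp_all
qed

text \<open>The category axioms are checked here for the common model; functoriality of
  \<open>pull p f\<^sub>1\<close> gives closure under identities and composition.\<close>

lemma structured_action: "structured (fiber p (Dom B f)) action_objects action_mor"
proof -
  interpret F: category "fiber p (Dom B f)" by (rule category_fiber)
  show ?thesis
  proof
    fix x assume x: "x \<in> action_objects"
    obtain X u where [simp]: "x = (X, u)" by (cases x)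
    have "premor X u" using x by (simp add: action_objects_def)
    note [simp] = premor_simps[OF this]
    show "fst x \<in> Ob (fiber p (Dom B f))" by simp
    show "action_mor x x (Idm (fiber p (Dom B f)) (fst x))"
      by (simp add: action_mor_def pull_id)
  next
    fix x y z g h
    assume xyz: "x \<in> action_objects" "y \<in> action_objects" "z \<in> action_objects"
      and h: "h \<in> Hom (fiber p (Dom B f)) (fst x) (fst y)" and g: "g \<in> Hom (fiber p (Dom B f)) (fst y) (fst z)"
      and eq: "action_mor x y h" "action_mor y z g"
    obtain X u Y v Z w where [simp]: "x = (X, u)" "y = (Y, v)" "z = (Z, w)"
      by (cases x; cases y; cases z)
    have "premor X u" "premor Y v" "premor Z w" using xyz by (simp_all add: action_objects_def)
    note [simp] = this[THEN premor_simps(1)] this[THEN premor_simps(2)] this[THEN premor_simps(3)]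
      this[THEN premor_simps(4)] this[THEN premor_simps(5)] this[THEN premor_simps(6)]
    have [simp]: "h \<in> Mor E" "g \<in> Mor E" "Dom E h = X" "Cod E h = Y" "Dom E g = Y" "Cod E g = Z"
      "P h = Idm B (Dom B f)" "P g = Idm B (Dom B f)"
      using h g by (simp_all add: Hom_fiber)
    have e: "h \<cdot> u = v \<cdot> on_mor (pull p f\<^sub>1) h" "g \<cdot> v = w \<cdot> on_mor (pull p f\<^sub>1) g"
      using eq by (simp_all add: action_mor_def)
    have "(g \<cdot> h) \<cdot> u = w \<cdot> on_mor (pull p f\<^sub>1) (g \<cdot> h)"
      using reassoc[OF e(2), of "on_mor (pull p f\<^sub>1) h"] by (simp add: e(1) pull_comp)
    then show "action_mor x z (g \<bullet>\<^bsub>fiber p (Dom B f)\<^esub> h)" by (simp add: action_mor_def)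
  qed
qed

text \<open>By the universal property of \<open>e X\<close>, vertical morphisms from
  \<open>Z X\<close> to \<open>X\<close> correspond to morphisms over \<open>f\<^sub>2\<close> from
  \<open>pull_ob f\<^sub>1 X\<close> to \<open>X\<close>. It is applied with
  \<open>kernel_lift X\<close> for algebras and with the chosen cocartesian lift for
  actions.\<close>

lemma bij_betw_precomp:
  assumes e: "\<And>X. \<lbrakk>X \<in> Ob E; P\<^sub>o X = Dom B f\<rbrakk> \<Longrightarrow>
      is_cocartesian p (e X) \<and> Dom E (e X) = pull_ob f\<^sub>1 X \<and> Cod E (e X) = Z X \<and> P (e X) = f\<^sub>2"
    and S: "\<And>X a. (X, a) \<in> S \<longleftrightarrow> X \<in> Ob E \<and> P\<^sub>o X = Dom B f \<and> a \<in> Hom (fiber p (Dom B f)) (Z X) X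
      \<and> lawful X (a \<cdot> e X)"
  shows "bij_betw (\<lambda>(X, a). (X, a \<cdot> e X)) S action_objects"
proof (rule bij_betw_imageI)
  have e' [simp]: "is_cocartesian p (e X)" "Dom E (e X) = pull_ob f\<^sub>1 X" "Cod E (e X) = Z X" "P (e X) = f\<^sub>2"
    "e X \<in> Mor E"
    if "X \<in> Ob E" "P\<^sub>o X = Dom B f" for X using e[OF that] by simp_all
  show "inj_on (\<lambda>(X, a). (X, a \<cdot> e X)) S"
  proof (rule inj_onI, clarsimp)
    fix X a b assume ab: "(X, a) \<in> S" "(X, b) \<in> S" and eq: "a \<cdot> e X = b \<cdot> e X"
    then have X: "X \<in> Ob E" "P\<^sub>o X = Dom B f" by (simp_all add: S)
    show "a = b" by (rule cocartesian_cancel[OF e'(1)[OF X] eq]) (use ab X in \<open>simp_all add: S Hom_fiber\<close>)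
  qed
  show "(\<lambda>(X, a). (X, a \<cdot> e X)) ` S = action_objects"
  proof (intro equalityI subsetI)
    fix x assume "x \<in> (\<lambda>(X, a). (X, a \<cdot> e X)) ` S"
    then obtain X a where x: "x = (X, a \<cdot> e X)" and a: "(X, a) \<in> S" by auto
    have "X \<in> Ob E" "P\<^sub>o X = Dom B f" "a \<in> Mor E" "Dom E a = Z X" "Cod E a = X" "P a = Idm B (Dom B f)"
      "lawful X (a \<cdot> e X)"
      using a by (simp_all add: S Hom_fiber)
    then show "x \<in> action_objects" by (simp add: x action_objects_def premor_def)
  next
    fix x assume "x \<in> action_objects"
    then obtain X u where x: "x = (X, u)" and u: "premor X u" "lawful X u"
      by (auto simp: action_objects_def)
    note [simp] = premor_simps[OF u(1)]
    have "\<exists>!a. a \<in> Hom (fiber p (Dom B f)) (Z X) X \<and> a \<cdot> e X = u"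
      by (rule fiber_colift_ex1) simp_all
    then obtain a where a: "a \<in> Hom (fiber p (Dom B f)) (Z X) X" "a \<cdot> e X = u" by blast
    then have "(X, a) \<in> S" using u by (simp add: S)
    then show "x \<in> (\<lambda>(X, a). (X, a \<cdot> e X)) ` S" using a(2) x by force
  qed
qed

subsection \<open>Algebras of the monad\<close>

text \<open>By the equation for mates, this is the factorisation of
  \<open>cocart p f X \<cdot> cart p f\<^sub>1 X\<close> through the cartesian lift of
  \<open>f\<close> that lies over \<open>f\<^sub>2\<close>.\<close>

definition kernel_lift where
  "kernel_lift X = BC p f\<^sub>1 f\<^sub>2 f f X \<cdot> cocart p f\<^sub>2 (pull_ob f\<^sub>1 X)"

lemma kernel_lift_simps [simp]:
  assumes X [simp]: "X \<in> Ob E" "P\<^sub>o X = Dom B f"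
  shows "kernel_lift X \<in> Mor E" "Dom E (kernel_lift X) = pull_ob f\<^sub>1 X"
    "Cod E (kernel_lift X) = pull_ob f (push_ob f X)" "P (kernel_lift X) = f\<^sub>2"
    "cart p f (push_ob f X) \<cdot> kernel_lift X = cocart p f X \<cdot> cart p f\<^sub>1 X"
    "\<lbrakk>x \<in> Mor E; Cod E x = pull_ob f\<^sub>1 X\<rbrakk> \<Longrightarrow>
      cart p f (push_ob f X) \<cdot> (kernel_lift X \<cdot> x) = cocart p f X \<cdot> (cart p f\<^sub>1 X \<cdot> x)"
    "is_cocartesian p (kernel_lift X)"
proof -
  show 1: "kernel_lift X \<in> Mor E" "Dom E (kernel_lift X) = pull_ob f\<^sub>1 X"
    "Cod E (kernel_lift X) = pull_ob f (push_ob f X)" "P (kernel_lift X) = f\<^sub>2"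
    and 2: "cart p f (push_ob f X) \<cdot> kernel_lift X = cocart p f X \<cdot> cart p f\<^sub>1 X"
    unfolding kernel_lift_def BC_eq_mate by simp_all
  show "cart p f (push_ob f X) \<cdot> (kernel_lift X \<cdot> x) = cocart p f X \<cdot> (cart p f\<^sub>1 X \<cdot> x)"
    if "x \<in> Mor E" "Cod E x = pull_ob f\<^sub>1 X"
    using reassoc[OF 2, of x] 1 that by simp
  show "is_cocartesian p (kernel_lift X)"
    by (rule cocartesian_over_pullback[OF bc kernel, of X "cocart p f X"]) (simp_all add: 1 2)
qed

text \<open>The unit of the monad is \<open>kernel_lift X \<cdot> diag_lift X\<close>, which settles
  the unit law. Associativity is tested on a cocartesian \<open>t\<close> over
  \<open>\<pi>\<^sub>1\<close> followed by a second instance of \<open>kernel_lift\<close>; there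
  the multiplication yields \<open>comp_lift\<close> and the monad applied to
  \<open>\<alpha>\<close> yields \<open>step_lift\<close>.\<close>

lemma algebra_laws:
  assumes X [simp]: "X \<in> Ob E" "P\<^sub>o X = Dom B f"
    and \<alpha> [simp]: "\<alpha> \<in> Mor E" "Dom E \<alpha> = pull_ob f (push_ob f X)" "Cod E \<alpha> = X" "P \<alpha> = Idm B (Dom B f)"
  shows "\<alpha> \<cdot> unit p f X = Idm E X \<and>
      \<alpha> \<cdot> on_mor (pull p f) (counit p f (push_ob f X)) = \<alpha> \<cdot> on_mor (pull p f) (on_mor (push p f) \<alpha>)
    \<longleftrightarrow> lawful X (\<alpha> \<cdot> kernel_lift X)"
proof -
  define u where "u = \<alpha> \<cdot> kernel_lift X"
  let ?T = "pull_ob f (push_ob f X)"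
  let ?\<mu> = "on_mor (pull p f) (counit p f (push_ob f X))"
  let ?T\<alpha> = "on_mor (pull p f) (on_mor (push p f) \<alpha>)"
  have u: "premor X u" by (simp add: premor_def u_def)
  note [simp] = step_lift_simps[OF u] step_lift_simps[OF u, unfolded u_def]
  \<comment> \<open>\<open>t\<close> is the side opposite to \<open>kernel_lift X\<close> in the
    square with the cartesian lifts of \<open>\<pi>\<^sub>2\<close> and \<open>f\<^sub>1\<close>;
    the Beck-Chevalley condition for composable pairs makes it cocartesian.\<close>
  define t where "t = lift (cart p f\<^sub>1 ?T) (kernel_lift X \<cdot> cart p \<pi>\<^sub>2 (pull_ob f\<^sub>1 X)) \<pi>\<^sub>1"
  have t [simp]: "t \<in> Mor E" "Dom E t = pull_ob \<pi>\<^sub>2 (pull_ob f\<^sub>1 X)" "Cod E t = pull_ob f\<^sub>1 ?T" "P t = \<pi>\<^sub>1"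
    "cart p f\<^sub>1 ?T \<cdot> t = kernel_lift X \<cdot> cart p \<pi>\<^sub>2 (pull_ob f\<^sub>1 X)"
    unfolding t_def by simp_all
  have t_cocart: "is_cocartesian p t"
    by (rule cocartesian_over_pullback[OF bc comp_square, of "pull_ob f\<^sub>1 X" "kernel_lift X"]) simp_all
  have unit: "kernel_lift X \<cdot> diag_lift X = unit p f X"
    by (rule cart_cancel[of f "push_ob f X"]) simp_all
  \<comment> \<open>Both sides lie over \<open>f\<^sub>2 \<star> \<pi>\<^sub>1\<close>, and after
    the lift of \<open>f\<close> both become \<open>cocart p f X \<cdot> cart p f\<^sub>1 X \<cdot>
    cart p \<pi>\<^sub>2 (pull_ob f\<^sub>1 X)\<close>.\<close>
  have mult: "?\<mu> \<cdot> (kernel_lift ?T \<cdot> t) = kernel_lift X \<cdot> comp_lift X"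
    by (rule cart_cancel[of f "push_ob f X"]) simp_all
  have act: "?T\<alpha> \<cdot> (kernel_lift ?T \<cdot> t) = kernel_lift X \<cdot> step_lift X u"
    by (rule cart_cancel[of f "push_ob f X"]) (simp_all add: u_def)
  have "\<alpha> \<cdot> ?\<mu> = \<alpha> \<cdot> ?T\<alpha> \<longleftrightarrow> (\<alpha> \<cdot> ?\<mu>) \<cdot> (kernel_lift ?T \<cdot> t) = (\<alpha> \<cdot> ?T\<alpha>) \<cdot> (kernel_lift ?T \<cdot> t)"
    by (rule cocartesian_comp_cancel_iff[OF t_cocart, symmetric]) simp_all
  also have "\<dots> \<longleftrightarrow> \<alpha> \<cdot> (kernel_lift X \<cdot> comp_lift X) = \<alpha> \<cdot> (kernel_lift X \<cdot> step_lift X u)"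
    by (simp add: mult act)
  also have "\<dots> \<longleftrightarrow> u \<cdot> step_lift X u = u \<cdot> comp_lift X"
    by (simp add: u_def eq_commute)
  finally show ?thesis by (simp add: lawful_def unit flip: u_def) (simp add: u_def unit)
qed

text \<open>Since \<open>kernel_lift\<close> is natural and cocartesian, compatibility of
  \<open>h\<close> with the algebra structures can be tested after precomposing with it, where it
  becomes compatibility with the actions.\<close>

lemma EM_structured:
  obtains S R where "EM p f = structured_cat (fiber p (Dom B f)) S R"
    "bij_betw (\<lambda>(X, \<alpha>). (X, \<alpha> \<cdot> kernel_lift X)) S action_objects"
    "\<And>x y h. \<lbrakk>x \<in> S; y \<in> S; h \<in> Hom (fiber p (Dom B f)) (fst x) (fst y)\<rbrakk> \<Longrightarrow>
      R x y h \<longleftrightarrow> action_mor ((\<lambda>(X, \<alpha>). (X, \<alpha> \<cdot> kernel_lift X)) x) ((\<lambda>(X, \<alpha>). (X, \<alpha> \<cdot> kernel_lift X)) y) h"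
proof
  let ?C = "fiber p (Dom B f)" and ?T = "pull p f \<circ>\<^sub>F push p f"
  let ?S = "{(X, \<alpha>). X \<in> Ob ?C \<and> \<alpha> \<in> Hom ?C (on_ob ?T X) X \<and> \<alpha> \<bullet>\<^bsub>?C\<^esub> unit p f X = Idm ?C X \<and>
    \<alpha> \<bullet>\<^bsub>?C\<^esub> (pull p f \<rhd> (counit p f \<lhd> push p f)) X = \<alpha> \<bullet>\<^bsub>?C\<^esub> on_mor ?T \<alpha>}"
  let ?R = "\<lambda>(X, \<alpha>) (Y, \<alpha>') h. h \<bullet>\<^bsub>?C\<^esub> \<alpha> = \<alpha>' \<bullet>\<^bsub>?C\<^esub> on_mor ?T h"
  show "EM p f = structured_cat ?C ?S ?R" by (simp add: EM_def algebra_cat_def)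
  have S: "(X, \<alpha>) \<in> ?S \<longleftrightarrow> X \<in> Ob E \<and> P\<^sub>o X = Dom B f \<and> \<alpha> \<in> Hom ?C (pull_ob f (push_ob f X)) X
      \<and> lawful X (\<alpha> \<cdot> kernel_lift X)" for X \<alpha>
    using algebra_laws[of X \<alpha>] by (auto simp: Hom_fiber whisker_left_def whisker_right_def)
  then show "bij_betw (\<lambda>(X, \<alpha>). (X, \<alpha> \<cdot> kernel_lift X)) ?S action_objects"
    by (intro bij_betw_precomp[where Z = "\<lambda>X. pull_ob f (push_ob f X)"]) simp_all
  fix x y h assume x: "x \<in> ?S" and y: "y \<in> ?S" and h: "h \<in> Hom ?C (fst x) (fst y)"
  obtain X \<alpha> Y \<beta> where xy [simp]: "x = (X, \<alpha>)" "y = (Y, \<beta>)" by (cases x; cases y)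
  have [simp]: "X \<in> Ob E" "P\<^sub>o X = Dom B f" "Y \<in> Ob E" "P\<^sub>o Y = Dom B f"
    "\<alpha> \<in> Mor E" "Dom E \<alpha> = pull_ob f (push_ob f X)" "Cod E \<alpha> = X" "P \<alpha> = Idm B (Dom B f)"
    "\<beta> \<in> Mor E" "Dom E \<beta> = pull_ob f (push_ob f Y)" "Cod E \<beta> = Y" "P \<beta> = Idm B (Dom B f)"
    "h \<in> Mor E" "Dom E h = X" "Cod E h = Y" "P h = Idm B (Dom B f)"
    using x y h unfolding xy S by (simp_all add: Hom_fiber)
  let ?Th = "on_mor (pull p f) (on_mor (push p f) h)"
  have nat: "?Th \<cdot> kernel_lift X = kernel_lift Y \<cdot> on_mor (pull p f\<^sub>1) h"
    by (rule cart_cancel[of f "push_ob f Y"]) simp_all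
  have "h \<cdot> \<alpha> = \<beta> \<cdot> ?Th \<longleftrightarrow> (h \<cdot> \<alpha>) \<cdot> kernel_lift X = (\<beta> \<cdot> ?Th) \<cdot> kernel_lift X"
    by (rule cocartesian_cancel_iff[symmetric]) simp_all
  then show "?R x y h \<longleftrightarrow> action_mor ((\<lambda>(X, \<alpha>). (X, \<alpha> \<cdot> kernel_lift X)) x) ((\<lambda>(X, \<alpha>). (X, \<alpha> \<cdot> kernel_lift X)) y) h"
    by (simp add: action_mor_def nat)
qed

subsection \<open>The canonical transformations of the kernel pair\<close>

lemma j_eq_canon: "j1 p K = canon f\<^sub>1 \<pi>\<^sub>2 f\<^sub>1 \<pi>" "j2 p K = canon f\<^sub>2 \<pi>\<^sub>1 f\<^sub>2 \<pi>" "j12 p K = canon f\<^sub>1 \<pi>\<^sub>1 f\<^sub>2 \<pi>\<^sub>2"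
  by (simp_all add: j1_def j2_def j12_def canon_def)

lemma d_simps [simp]:
  assumes [simp]: "X \<in> Ob E" "P\<^sub>o X = Dom B f"
  shows "d1 p K X \<in> Mor E" "Dom E (d1 p K X) = X" "Cod E (d1 p K X) = pull_ob \<Delta> (pull_ob f\<^sub>1 X)"
    "P (d1 p K X) = Idm B (Dom B f)"
    "inverse_of E (d2 p K X) = cart p f\<^sub>2 X \<cdot> cart p \<Delta> (pull_ob f\<^sub>2 X)"
  unfolding d1_def d2_def using section_canon[of f\<^sub>1 \<Delta> "Dom B f" X] section_canon[of f\<^sub>2 \<Delta> "Dom B f" X] by simp_all

text \<open>Composed with a cartesian lift, the canonical isomorphism turns into the explicit lift
  used in \<open>lawful\<close>. The last equation of \<open>inverse_j1_simps\<close> does the same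
  for \<open>comp_lift\<close>.\<close>

lemma cart_d1 [simp]:
  assumes [simp]: "X \<in> Ob E" "P\<^sub>o X = Dom B f"
  shows "cart p \<Delta> (pull_ob f\<^sub>1 X) \<cdot> d1 p K X = diag_lift X"
proof (rule cart_cancel[of f\<^sub>1 X])
  show "cart p f\<^sub>1 X \<cdot> (cart p \<Delta> (pull_ob f\<^sub>1 X) \<cdot> d1 p K X) = cart p f\<^sub>1 X \<cdot> diag_lift X"
    using section_canon(5)[of f\<^sub>1 \<Delta> "Dom B f" X] by (simp add: d1_def)
qed simp_all

lemma inverse_j1_simps [simp]:
  assumes [simp]: "X \<in> Ob E" "P\<^sub>o X = Dom B f"
  defines "i \<equiv> inverse_of E (j1 p K X)"
  shows "i \<in> Mor E" "Dom E i = pull_ob \<pi>\<^sub>2 (pull_ob f\<^sub>1 X)" "Cod E i = pull_ob \<pi> (pull_ob f\<^sub>1 X)"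
    "P i = Idm B (Dom B \<pi>\<^sub>2)" "cart p \<pi> (pull_ob f\<^sub>1 X) \<cdot> i = comp_lift X"
proof -
  note [simp] = canon_iso proj_inverse_canon
  show 1: "i \<in> Mor E" "Dom E i = pull_ob \<pi>\<^sub>2 (pull_ob f\<^sub>1 X)" "Cod E i = pull_ob \<pi> (pull_ob f\<^sub>1 X)"
    "P i = Idm B (Dom B \<pi>\<^sub>2)"
    unfolding i_def j_eq_canon by simp_all
  show "cart p \<pi> (pull_ob f\<^sub>1 X) \<cdot> i = comp_lift X"
    by (rule cart_cancel[of f\<^sub>1 X])
      (use 1 cart_inverse_canon[of f\<^sub>1 \<pi>\<^sub>2 f\<^sub>1 \<pi> X] in \<open>simp_all add: i_def j_eq_canon\<close>)
qed

subsection \<open>Actions of the kernel pair\<close>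

text \<open>The inverse of \<open>d2\<close> is the composite of the lifts of
  \<open>f\<^sub>2\<close> and \<open>\<Delta>\<close>. The lift of \<open>\<Delta>\<close> moves
  past the unit by naturality and meets \<open>d1\<close>, giving \<open>diag_lift\<close>; the lift
  of \<open>f\<^sub>2\<close> turns the unit into a cocartesian lift.\<close>

lemma act_unit_eq:
  assumes [simp]: "X \<in> Ob E" "P\<^sub>o X = Dom B f"
  shows "act_unit p K X = cocart p f\<^sub>2 (pull_ob f\<^sub>1 X) \<cdot> diag_lift X"
  by (simp add: act_unit_def vcomp_def whisker_left_def whisker_right_def inv_trans_def)

text \<open>As for algebras, associativity is tested on a composite of cocartesian morphisms over
  \<open>\<pi>\<^sub>1\<close> and \<open>f\<^sub>2\<close>, on which \<open>act_mult\<close>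
  produces \<open>comp_lift\<close> and the functor applied to \<open>\<beta>\<close> produces
  \<open>step_lift\<close>.\<close>

lemma act_laws:
  assumes X [simp]: "X \<in> Ob E" "P\<^sub>o X = Dom B f"
    and \<beta> [simp]: "\<beta> \<in> Mor E" "Dom E \<beta> = push_ob f\<^sub>2 (pull_ob f\<^sub>1 X)" "Cod E \<beta> = X" "P \<beta> = Idm B (Dom B f)"
  shows "\<beta> \<cdot> act_unit p K X = Idm E X \<and>
      \<beta> \<cdot> act_mult p K X = \<beta> \<cdot> on_mor (push p f\<^sub>2) (on_mor (pull p f\<^sub>1) \<beta>)
    \<longleftrightarrow> lawful X (\<beta> \<cdot> cocart p f\<^sub>2 (pull_ob f\<^sub>1 X))"
proof -
  let ?Z = "pull_ob f\<^sub>1 X"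
  let ?T = "push_ob f\<^sub>2 ?Z"
  let ?T\<beta> = "on_mor (push p f\<^sub>2) (on_mor (pull p f\<^sub>1) \<beta>)"
  let ?c = "cocart p f\<^sub>2 (pull_ob f\<^sub>1 ?T)"
  define u where "u = \<beta> \<cdot> cocart p f\<^sub>2 ?Z"
  have u: "premor X u" by (simp add: premor_def u_def)
  note [simp] = step_lift_simps[OF u] step_lift_simps[OF u, unfolded u_def]
  let ?BC = "BC p \<pi>\<^sub>2 \<pi>\<^sub>1 f\<^sub>1 f\<^sub>2 ?Z"
  \<comment> \<open>With the Beck-Chevalley component as last factor of \<open>t\<close>, the
    inverse component inside \<open>act_mult\<close> can cancel it.\<close>
  define t where "t = ?BC \<cdot> cocart p \<pi>\<^sub>1 (pull_ob \<pi>\<^sub>2 ?Z)"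
  have BC: "?BC \<in> Mor E" "Dom E ?BC = push_ob \<pi>\<^sub>1 (pull_ob \<pi>\<^sub>2 ?Z)" "Cod E ?BC = pull_ob f\<^sub>1 ?T"
    "P ?BC = Idm B (Dom B f\<^sub>1)"
    unfolding BC_eq_mate by simp_all
  have t [simp]: "t \<in> Mor E" "Dom E t = pull_ob \<pi>\<^sub>2 ?Z" "Cod E t = pull_ob f\<^sub>1 ?T" "P t = \<pi>\<^sub>1"
    "cart p f\<^sub>1 ?T \<cdot> t = cocart p f\<^sub>2 ?Z \<cdot> cart p \<pi>\<^sub>2 ?Z"
    unfolding t_def BC_eq_mate by simp_all
  have t_cocart: "is_cocartesian p t"
    by (rule cocartesian_over_pullback[OF bc comp_square, of ?Z "cocart p f\<^sub>2 ?Z"]) simp_all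
  have iso: "is_iso (fiber p (Dom B f\<^sub>1)) ?BC" using BC_iso[OF bc comp_square, of ?Z] by simp
  note [simp] = is_iso_total[OF iso] proj_inverse[OF iso]
  have inv_t: "inverse_of E ?BC \<cdot> t = cocart p \<pi>\<^sub>1 (pull_ob \<pi>\<^sub>2 ?Z)"
    unfolding t_def using reassoc[OF proj.C.inverse_of_simps(4)[OF is_iso_total[OF iso]], of "cocart p \<pi>\<^sub>1 (pull_ob \<pi>\<^sub>2 ?Z)"]
    by (simp add: BC)
  let ?W = "pull_ob \<pi> ?Z"
  have k2: "k2 p K ?W \<in> Mor E" "Dom E (k2 p K ?W) = push_ob f\<^sub>2 (push_ob \<pi>\<^sub>1 ?W)"
    "Cod E (k2 p K ?W) = push_ob f\<^sub>2 (push_ob \<pi> ?W)" "P (k2 p K ?W) = Idm B (Dom B f)"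
    and k2_eq: "k2 p K ?W \<cdot> (cocart p f\<^sub>2 (push_ob \<pi>\<^sub>1 ?W) \<cdot> cocart p \<pi>\<^sub>1 ?W) =
      cocart p f\<^sub>2 (push_ob \<pi> ?W) \<cdot> cocart p \<pi> ?W"
    unfolding k2_def j_eq_canon K_simps using twofold_mate_canon[of f\<^sub>2 \<pi> f\<^sub>2 \<pi>\<^sub>1 ?W] by simp_all
  have \<mu>: "act_mult p K X = on_mor (push p f\<^sub>2) (counit p \<pi> ?Z) \<cdot>
      ((k2 p K ?W \<cdot> on_mor (push p f\<^sub>2) (on_mor (push p \<pi>\<^sub>1) (inverse_of E (j1 p K X))))
        \<cdot> on_mor (push p f\<^sub>2) (inverse_of E ?BC))"
    by (simp add: act_mult_def vcomp_def hcomp_def whisker_left_def whisker_right_def inv_trans_def)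
  have \<mu>_simps [simp]: "act_mult p K X \<in> Mor E" "Dom E (act_mult p K X) = push_ob f\<^sub>2 (pull_ob f\<^sub>1 ?T)"
    "Cod E (act_mult p K X) = ?T" "P (act_mult p K X) = Idm B (Dom B f)"
    unfolding \<mu> by (simp_all add: k2 BC)
  have unit: "act_unit p K X = cocart p f\<^sub>2 ?Z \<cdot> diag_lift X" by (simp add: act_unit_eq)
  have k2_comp: "k2 p K ?W \<cdot> (cocart p f\<^sub>2 (push_ob \<pi>\<^sub>1 ?W) \<cdot> (cocart p \<pi>\<^sub>1 ?W \<cdot> x)) =
      cocart p f\<^sub>2 (push_ob \<pi> ?W) \<cdot> (cocart p \<pi> ?W \<cdot> x)" if "x \<in> Mor E" "Cod E x = ?W" for x
    using reassoc[OF k2_eq, of x] that k2 by simp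
  \<comment> \<open>In order: the inverse Beck-Chevalley component reduces \<open>t\<close> to a
    chosen lift, \<open>k2\<close> exchanges the cocartesian lifts of \<open>\<pi>\<^sub>1\<close>
    and \<open>f\<^sub>2\<close> for those of \<open>\<pi>\<close> and \<open>f\<^sub>2\<close>, the
    counit makes the lift of \<open>\<pi>\<close> cartesian, and the inverse of \<open>j1\<close>
    completes it to \<open>comp_lift\<close>.\<close>
  have mult: "act_mult p K X \<cdot> (?c \<cdot> t) = cocart p f\<^sub>2 ?Z \<cdot> comp_lift X"
    unfolding \<mu> by (simp add: k2 BC inv_t k2_comp)
  have step: "on_mor (pull p f\<^sub>1) \<beta> \<cdot> t = step_lift X u"
    by (rule cart_cancel[of f\<^sub>1 X]) (simp_all add: u_def)
  have act: "?T\<beta> \<cdot> (?c \<cdot> t) = cocart p f\<^sub>2 ?Z \<cdot> step_lift X u"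
    by (simp add: step)
  have "\<beta> \<cdot> act_mult p K X = \<beta> \<cdot> ?T\<beta> \<longleftrightarrow> (\<beta> \<cdot> act_mult p K X) \<cdot> (?c \<cdot> t) = (\<beta> \<cdot> ?T\<beta>) \<cdot> (?c \<cdot> t)"
    by (rule cocartesian_comp_cancel_iff[OF t_cocart, symmetric]) simp_all
  also have "\<dots> \<longleftrightarrow> \<beta> \<cdot> (cocart p f\<^sub>2 ?Z \<cdot> comp_lift X) = \<beta> \<cdot> (cocart p f\<^sub>2 ?Z \<cdot> step_lift X u)"
    using mult act by simp
  also have "\<dots> \<longleftrightarrow> u \<cdot> step_lift X u = u \<cdot> comp_lift X"
    by (simp add: u_def eq_commute)
  finally show ?thesis by (simp add: lawful_def flip: u_def) (simp add: u_def unit)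
qed

lemma Act_structured:
  obtains S R where "Act p K = structured_cat (fiber p (Dom B f)) S R"
    "bij_betw (\<lambda>(X, \<beta>). (X, \<beta> \<cdot> cocart p f\<^sub>2 (pull_ob f\<^sub>1 X))) S action_objects"
    "\<And>x y h. \<lbrakk>x \<in> S; y \<in> S; h \<in> Hom (fiber p (Dom B f)) (fst x) (fst y)\<rbrakk> \<Longrightarrow>
      R x y h \<longleftrightarrow> action_mor ((\<lambda>(X, \<beta>). (X, \<beta> \<cdot> cocart p f\<^sub>2 (pull_ob f\<^sub>1 X))) x)
        ((\<lambda>(X, \<beta>). (X, \<beta> \<cdot> cocart p f\<^sub>2 (pull_ob f\<^sub>1 X))) y) h"
proof
  let ?C = "fiber p (Dom B f)" and ?T = "push p f\<^sub>2 \<circ>\<^sub>F pull p f\<^sub>1"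
  let ?\<Phi> = "\<lambda>(X, \<beta>). (X, \<beta> \<cdot> cocart p f\<^sub>2 (pull_ob f\<^sub>1 X))"
  let ?S = "{(X, \<alpha>). X \<in> Ob ?C \<and> \<alpha> \<in> Hom ?C (on_ob ?T X) X \<and> \<alpha> \<bullet>\<^bsub>?C\<^esub> act_unit p K X = Idm ?C X \<and>
    \<alpha> \<bullet>\<^bsub>?C\<^esub> act_mult p K X = \<alpha> \<bullet>\<^bsub>?C\<^esub> on_mor ?T \<alpha>}"
  let ?R = "\<lambda>(X, \<alpha>) (Y, \<alpha>') h. h \<bullet>\<^bsub>?C\<^esub> \<alpha> = \<alpha>' \<bullet>\<^bsub>?C\<^esub> on_mor ?T h"
  show "Act p K = structured_cat ?C ?S ?R" by (simp add: Act_def algebra_cat_def)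
  have S: "(X, \<alpha>) \<in> ?S \<longleftrightarrow> X \<in> Ob E \<and> P\<^sub>o X = Dom B f \<and> \<alpha> \<in> Hom ?C (push_ob f\<^sub>2 (pull_ob f\<^sub>1 X)) X
      \<and> lawful X (\<alpha> \<cdot> cocart p f\<^sub>2 (pull_ob f\<^sub>1 X))" for X \<alpha>
    using act_laws[of X \<alpha>] by (auto simp: Hom_fiber)
  then show "bij_betw ?\<Phi> ?S action_objects"
    by (intro bij_betw_precomp[where Z = "\<lambda>X. push_ob f\<^sub>2 (pull_ob f\<^sub>1 X)"]) simp_all
  fix x y h assume x: "x \<in> ?S" and y: "y \<in> ?S" and h: "h \<in> Hom ?C (fst x) (fst y)"
  obtain X \<alpha> Y \<beta> where xy [simp]: "x = (X, \<alpha>)" "y = (Y, \<beta>)" by (cases x; cases y)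
  have [simp]: "X \<in> Ob E" "P\<^sub>o X = Dom B f" "Y \<in> Ob E" "P\<^sub>o Y = Dom B f"
    "\<alpha> \<in> Mor E" "Dom E \<alpha> = push_ob f\<^sub>2 (pull_ob f\<^sub>1 X)" "Cod E \<alpha> = X" "P \<alpha> = Idm B (Dom B f)"
    "\<beta> \<in> Mor E" "Dom E \<beta> = push_ob f\<^sub>2 (pull_ob f\<^sub>1 Y)" "Cod E \<beta> = Y" "P \<beta> = Idm B (Dom B f)"
    "h \<in> Mor E" "Dom E h = X" "Cod E h = Y" "P h = Idm B (Dom B f)"
    using x y h unfolding xy S by (simp_all add: Hom_fiber)
  let ?Th = "on_mor (push p f\<^sub>2) (on_mor (pull p f\<^sub>1) h)"
  let ?c = "cocart p f\<^sub>2 (pull_ob f\<^sub>1 X)"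
  have "h \<cdot> \<alpha> = \<beta> \<cdot> ?Th \<longleftrightarrow> (h \<cdot> \<alpha>) \<cdot> ?c = (\<beta> \<cdot> ?Th) \<cdot> ?c"
    by (rule cocartesian_cancel_iff[symmetric]) simp_all
  then show "?R x y h \<longleftrightarrow> action_mor (?\<Phi> x) (?\<Phi> y) h"
    by (simp add: action_mor_def)
qed

subsection \<open>Descent data\<close>

text \<open>Dually to algebras, the two sides of the cocycle condition are compared after the lifts
  of \<open>\<pi>\<^sub>1\<close> and \<open>f\<^sub>2\<close>, whose composite is cartesian. There
  \<open>j12\<close> produces \<open>step_lift\<close>, while \<open>j2\<close> and the inverse of
  \<open>j1\<close> produce \<open>comp_lift\<close>.\<close>

lemma desc_laws:
  assumes X [simp]: "X \<in> Ob E" "P\<^sub>o X = Dom B f"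
    and \<phi> [simp]: "\<phi> \<in> Mor E" "Dom E \<phi> = pull_ob f\<^sub>1 X" "Cod E \<phi> = pull_ob f\<^sub>2 X" "P \<phi> = Idm B (Dom B f\<^sub>1)"
  shows "inv_trans p (d2 p K) X \<cdot> on_mor (pull p \<Delta>) \<phi> \<cdot> d1 p K X = Idm E X \<and>
      on_mor (pull p \<pi>\<^sub>1) \<phi> \<cdot> j12 p K X \<cdot> on_mor (pull p \<pi>\<^sub>2) \<phi>
        = j2 p K X \<cdot> on_mor (pull p \<pi>) \<phi> \<cdot> inv_trans p (j1 p K) X
    \<longleftrightarrow> lawful X (cart p f\<^sub>2 X \<cdot> \<phi>)"
proof -
  define u where "u = cart p f\<^sub>2 X \<cdot> \<phi>"
  have u: "premor X u" by (simp add: premor_def u_def)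
  note [simp] = step_lift_simps[OF u] step_lift_simps[OF u, unfolded u_def]
  let ?L = "on_mor (pull p \<pi>\<^sub>1) \<phi> \<cdot> j12 p K X \<cdot> on_mor (pull p \<pi>\<^sub>2) \<phi>"
  let ?R = "j2 p K X \<cdot> on_mor (pull p \<pi>) \<phi> \<cdot> inverse_of E (j1 p K X)"
  have j12: "j12 p K X \<in> Mor E" "Dom E (j12 p K X) = pull_ob \<pi>\<^sub>2 (pull_ob f\<^sub>2 X)"
    "Cod E (j12 p K X) = pull_ob \<pi>\<^sub>1 (pull_ob f\<^sub>1 X)" "P (j12 p K X) = Idm B (Dom B \<pi>\<^sub>2)"
    and j2: "j2 p K X \<in> Mor E" "Dom E (j2 p K X) = pull_ob \<pi> (pull_ob f\<^sub>2 X)"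
    "Cod E (j2 p K X) = pull_ob \<pi>\<^sub>1 (pull_ob f\<^sub>2 X)" "P (j2 p K X) = Idm B (Dom B \<pi>\<^sub>2)"
    unfolding j_eq_canon by simp_all
  have j2_comp: "cart p f\<^sub>2 X \<cdot> (cart p \<pi>\<^sub>1 (pull_ob f\<^sub>2 X) \<cdot> (j2 p K X \<cdot> x)) =
      cart p f\<^sub>2 X \<cdot> (cart p \<pi> (pull_ob f\<^sub>2 X) \<cdot> x)" if "x \<in> Mor E" "Cod E x = pull_ob \<pi> (pull_ob f\<^sub>2 X)" for x
    unfolding j_eq_canon using that by simp
  \<comment> \<open>After the lift of \<open>f\<^sub>1\<close>, \<open>j12\<close> exchanges the
    lifts of \<open>\<pi>\<^sub>1\<close> and \<open>f\<^sub>1\<close> for those of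
    \<open>\<pi>\<^sub>2\<close> and \<open>f\<^sub>2\<close>, and naturality leaves
    \<open>u\<close> after the lift of \<open>\<pi>\<^sub>2\<close>.\<close>
  have step: "cart p \<pi>\<^sub>1 (pull_ob f\<^sub>1 X) \<cdot> (j12 p K X \<cdot> on_mor (pull p \<pi>\<^sub>2) \<phi>) = step_lift X u"
    by (rule cart_cancel[of f\<^sub>1 X]) (simp_all add: j_eq_canon u_def)
  have L: "cart p f\<^sub>2 X \<cdot> (cart p \<pi>\<^sub>1 (pull_ob f\<^sub>2 X) \<cdot> ?L) = u \<cdot> step_lift X u"
    by (simp add: j12 step) (simp add: u_def)
  have R: "cart p f\<^sub>2 X \<cdot> (cart p \<pi>\<^sub>1 (pull_ob f\<^sub>2 X) \<cdot> ?R) = u \<cdot> comp_lift X"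
    by (simp add: j2_comp u_def)
  have "is_cartesian p (cart p f\<^sub>2 X \<cdot> cart p \<pi>\<^sub>1 (pull_ob f\<^sub>2 X))" by (intro cartesian_comp) simp_all
  then have "?L = ?R \<longleftrightarrow> (cart p f\<^sub>2 X \<cdot> cart p \<pi>\<^sub>1 (pull_ob f\<^sub>2 X)) \<cdot> ?L = (cart p f\<^sub>2 X \<cdot> cart p \<pi>\<^sub>1 (pull_ob f\<^sub>2 X)) \<cdot> ?R"
    by (rule cartesian_cancel_iff[symmetric]) (simp_all add: j12 j2)
  also have "\<dots> \<longleftrightarrow> u \<cdot> step_lift X u = u \<cdot> comp_lift X"
    using L R by (simp add: j12 j2)
  finally have assoc: "?L = ?R \<longleftrightarrow> u \<cdot> step_lift X u = u \<cdot> comp_lift X" .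
  have "inverse_of E (d2 p K X) \<cdot> on_mor (pull p \<Delta>) \<phi> \<cdot> d1 p K X = u \<cdot> diag_lift X"
    by (simp add: u_def)
  with assoc show ?thesis unfolding lawful_def inv_trans_def u_def[symmetric] by simp
qed

text \<open>Reading \<open>u \<cdot> lift (cart p f\<^sub>1 X) z h\<close> as the action of the generalised arrow \<open>h\<close> on the generalised
  element \<open>z\<close> of \<open>X\<close>, these are the two action laws.\<close>

lemma lawful_unit:
  assumes u: "premor X u" "lawful X u" and [simp]: "z \<in> Mor E" "Cod E z = X"
    and l: "l = \<Delta> \<star> P z"
  shows "u \<cdot> lift (cart p f\<^sub>1 X) z l = z"
proof -
  note [simp] = premor_simps[OF u(1)]
  have [simp]: "Cod B (P z) = Dom B f" using proj_simps(4)[of z] by simp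
  have c: "f\<^sub>1 \<star> (\<Delta> \<star> P z) = P z" using proj.D.assoc[of "P z" \<Delta> f\<^sub>1] by simp
  have "lift (cart p f\<^sub>1 X) z l = diag_lift X \<cdot> z"
    by (rule cart_cancel[of f\<^sub>1 X]) (simp_all add: l c)
  moreover have "u \<cdot> (diag_lift X \<cdot> z) = Idm E X \<cdot> z"
    using u(2) by (intro reassoc) (simp_all add: lawful_def)
  ultimately show ?thesis by simp
qed

lemma lawful_comp:
  assumes u: "premor X u" "lawful X u" and [simp]: "z \<in> Mor E" "Cod E z = X"
    and h [simp]: "h \<in> Mor B" "Dom B h = Dom B (P z)" "Cod B h = Dom B f\<^sub>1"
    and k [simp]: "k \<in> Mor B" "Dom B k = Dom B (P z)" "Cod B k = Dom B f\<^sub>1"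
    and l [simp]: "l \<in> Mor B" "Dom B l = Dom B (P z)" "Cod B l = Dom B f\<^sub>1"
    and eqs: "f\<^sub>1 \<star> h = P z" "f\<^sub>2 \<star> h = f\<^sub>1 \<star> k" "f\<^sub>1 \<star> l = P z" "f\<^sub>2 \<star> l = f\<^sub>2 \<star> k"
  shows "u \<cdot> lift (cart p f\<^sub>1 X) (u \<cdot> lift (cart p f\<^sub>1 X) z h) k = u \<cdot> lift (cart p f\<^sub>1 X) z l"
proof -
  note [simp] = premor_simps[OF u(1)] step_lift_simps[OF u(1)] eqs
  \<comment> \<open>\<open>m\<close> is the composable pair with first arrow \<open>h\<close> and
    second arrow \<open>k\<close>.\<close>
  have "\<exists>!m. m \<in> Hom B (Dom B (P z)) (Dom B \<pi>\<^sub>2) \<and> \<pi>\<^sub>2 \<star> m = h \<and> \<pi>\<^sub>1 \<star> m = k"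
    by (rule pullback_square_ex1[OF comp_square]) simp_all
  then obtain m where m [simp]: "m \<in> Mor B" "Dom B m = Dom B (P z)" "Cod B m = Dom B \<pi>\<^sub>2"
    "\<pi>\<^sub>2 \<star> m = h" "\<pi>\<^sub>1 \<star> m = k" by (auto simp: Hom_def)
  have \<pi>m: "f\<^sub>1 \<star> (\<pi> \<star> m) = f\<^sub>1 \<star> h" "f\<^sub>2 \<star> (\<pi> \<star> m) = f\<^sub>2 \<star> k"
    using proj.D.assoc[of m \<pi> f\<^sub>1] proj.D.assoc[of m \<pi> f\<^sub>2] proj.D.assoc[of m \<pi>\<^sub>2 f\<^sub>1]
      proj.D.assoc[of m \<pi>\<^sub>1 f\<^sub>2] by simp_all
  \<comment> \<open>\<open>l\<close> is given through its source and target, which determine an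
    arrow of a kernel pair; hence it is the composite of the pair \<open>m\<close>.\<close>
  have l_eq: "\<pi> \<star> m = l" by (rule kernel_cancel) (simp_all add: \<pi>m)
  define z1 where "z1 = lift (cart p f\<^sub>1 X) z h"
  have [simp]: "z1 \<in> Mor E" "Dom E z1 = Dom E z" "Cod E z1 = pull_ob f\<^sub>1 X" "P z1 = h"
    "cart p f\<^sub>1 X \<cdot> z1 = z" unfolding z1_def by simp_all
  \<comment> \<open>\<open>z2\<close> lies over \<open>m\<close> and pairs the element
    \<open>z\<close> with both arrows; the associativity law is restricted along it.\<close>
  define z2 where "z2 = lift (cart p \<pi>\<^sub>2 (pull_ob f\<^sub>1 X)) z1 m"
  have [simp]: "z2 \<in> Mor E" "Dom E z2 = Dom E z" "Cod E z2 = pull_ob \<pi>\<^sub>2 (pull_ob f\<^sub>1 X)" "P z2 = m"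
    "cart p \<pi>\<^sub>2 (pull_ob f\<^sub>1 X) \<cdot> z2 = z1" unfolding z2_def by simp_all
  have "lift (cart p f\<^sub>1 X) (u \<cdot> z1) k = step_lift X u \<cdot> z2"
    by (rule cart_cancel[of f\<^sub>1 X]) simp_all
  moreover have "lift (cart p f\<^sub>1 X) z l = comp_lift X \<cdot> z2"
    by (rule cart_cancel[of f\<^sub>1 X]) (simp_all add: l_eq)
  moreover have "u \<cdot> (step_lift X u \<cdot> z2) = (u \<cdot> comp_lift X) \<cdot> z2"
    using u(2) by (intro reassoc) (simp_all add: lawful_def)
  ultimately show ?thesis by (simp add: z1_def)
qed

text \<open>The swap \<open>s\<close> inverts the arrows of the kernel pair, and acting along an
  inverse arrow undoes the action. The inverse \<open>\<psi>\<close> is obtained by acting along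
  \<open>s\<close> and factoring through the lift of \<open>f\<^sub>1\<close>.\<close>

lemma lawful_imp_iso:
  assumes X [simp]: "X \<in> Ob E" "P\<^sub>o X = Dom B f"
    and \<phi> [simp]: "\<phi> \<in> Mor E" "Dom E \<phi> = pull_ob f\<^sub>1 X" "Cod E \<phi> = pull_ob f\<^sub>2 X" "P \<phi> = Idm B (Dom B f\<^sub>1)"
    and lawful: "lawful X (cart p f\<^sub>2 X \<cdot> \<phi>)"
  shows "is_iso (fiber p (Dom B f\<^sub>1)) \<phi>"
proof -
  define u where "u = cart p f\<^sub>2 X \<cdot> \<phi>"
  have u: "premor X u" "lawful X u" using lawful by (simp_all add: premor_def u_def)
  note [simp] = premor_simps[OF u(1)]
  \<comment> \<open>Since \<open>f \<star> f\<^sub>2 = f \<star> f\<^sub>1\<close>, the projections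
    in reversed order also factor through the kernel pair.\<close>
  have "\<exists>!s. s \<in> Hom B (Dom B f\<^sub>1) (Dom B f\<^sub>1) \<and> f\<^sub>1 \<star> s = f\<^sub>2 \<and> f\<^sub>2 \<star> s = f\<^sub>1"
    by (rule pullback_square_ex1[OF kernel]) simp_all
  then obtain s where s [simp]: "s \<in> Mor B" "Dom B s = Dom B f\<^sub>1" "Cod B s = Dom B f\<^sub>1"
    "f\<^sub>1 \<star> s = f\<^sub>2" "f\<^sub>2 \<star> s = f\<^sub>1" by (auto simp: Hom_def)
  let ?I = "Idm B (Dom B f\<^sub>1)"
  have \<Delta>: "f\<^sub>1 \<star> (\<Delta> \<star> f\<^sub>1) = f\<^sub>1" "f\<^sub>2 \<star> (\<Delta> \<star> f\<^sub>1) = f\<^sub>1" "f\<^sub>1 \<star> (\<Delta> \<star> f\<^sub>2) = f\<^sub>2" "f\<^sub>2 \<star> (\<Delta> \<star> f\<^sub>2) = f\<^sub>2"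
    using proj.D.assoc[of f\<^sub>1 \<Delta> f\<^sub>1] proj.D.assoc[of f\<^sub>1 \<Delta> f\<^sub>2] proj.D.assoc[of f\<^sub>2 \<Delta> f\<^sub>1]
      proj.D.assoc[of f\<^sub>2 \<Delta> f\<^sub>2] by simp_all
  define w where "w = lift (cart p f\<^sub>1 X) (cart p f\<^sub>2 X) s"
  have [simp]: "w \<in> Mor E" "Dom E w = pull_ob f\<^sub>2 X" "Cod E w = pull_ob f\<^sub>1 X" "P w = s"
    "cart p f\<^sub>1 X \<cdot> w = cart p f\<^sub>2 X" unfolding w_def by simp_all
  define \<psi> where "\<psi> = lift (cart p f\<^sub>1 X) (u \<cdot> w) ?I"
  have \<psi> [simp]: "\<psi> \<in> Mor E" "Dom E \<psi> = pull_ob f\<^sub>2 X" "Cod E \<psi> = pull_ob f\<^sub>1 X" "P \<psi> = ?I"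
    "cart p f\<^sub>1 X \<cdot> \<psi> = u \<cdot> w" unfolding \<psi>_def by simp_all
  \<comment> \<open>The arrow \<open>s\<close> runs from \<open>f\<^sub>2\<close> to
    \<open>f\<^sub>1\<close> and \<open>?I\<close> runs back; their composite is the identity arrow
    \<open>\<Delta> \<star> f\<^sub>2\<close>, to which the unit law applies.\<close>
  have "u \<cdot> \<psi> = u \<cdot> lift (cart p f\<^sub>1 X) (cart p f\<^sub>2 X) (\<Delta> \<star> f\<^sub>2)"
    unfolding \<psi>_def w_def by (rule lawful_comp[OF u]) (simp_all add: \<Delta>)
  also have "\<dots> = cart p f\<^sub>2 X" by (rule lawful_unit[OF u]) simp_all
  finally have u\<psi>: "u \<cdot> \<psi> = cart p f\<^sub>2 X" .
  have \<phi>\<psi>: "\<phi> \<cdot> \<psi> = Idm E (pull_ob f\<^sub>2 X)"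
    by (rule cart_cancel[of f\<^sub>2 X]) (use u\<psi> in \<open>simp_all add: u_def\<close>)
  \<comment> \<open>The identity is written as a lift so that \<open>u\<close> takes the shape of an
    action along \<open>?I\<close>, as \<open>lawful_comp\<close> expects.\<close>
  have id: "lift (cart p f\<^sub>1 X) (cart p f\<^sub>1 X) ?I = Idm E (pull_ob f\<^sub>1 X)"
    by (rule cart_cancel[of f\<^sub>1 X]) simp_all
  have "w \<cdot> \<phi> = lift (cart p f\<^sub>1 X) (u \<cdot> lift (cart p f\<^sub>1 X) (cart p f\<^sub>1 X) ?I) s"
    unfolding id
    by (rule cart_cancel[of f\<^sub>1 X])
      (use reassoc[of "cart p f\<^sub>1 X" w "cart p f\<^sub>2 X" \<phi>] in \<open>simp_all add: u_def\<close>)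
  then have "u \<cdot> (w \<cdot> \<phi>) = u \<cdot> lift (cart p f\<^sub>1 X) (u \<cdot> lift (cart p f\<^sub>1 X) (cart p f\<^sub>1 X) ?I) s"
    by simp
  also have "\<dots> = u \<cdot> lift (cart p f\<^sub>1 X) (cart p f\<^sub>1 X) (\<Delta> \<star> f\<^sub>1)"
    by (rule lawful_comp[OF u]) (simp_all add: \<Delta>)
  also have "\<dots> = cart p f\<^sub>1 X" by (rule lawful_unit[OF u]) simp_all
  finally have "u \<cdot> (w \<cdot> \<phi>) = cart p f\<^sub>1 X" .
  then have \<psi>\<phi>: "\<psi> \<cdot> \<phi> = Idm E (pull_ob f\<^sub>1 X)"
    by - (rule cart_cancel[of f\<^sub>1 X], use reassoc[OF \<psi>(5), of \<phi>] in simp_all)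
  show ?thesis unfolding is_iso_def is_inverse_def
    by (rule exI[of _ \<psi>]) (simp add: Hom_fiber \<phi>\<psi> \<psi>\<phi>)
qed

text \<open>Postcomposition with the cartesian lift of \<open>f\<^sub>2\<close> is bijective by the
  universal property. Coming back from a lawful action, the invertibility demanded of
  \<open>\<phi>\<close> is supplied by \<open>lawful_imp_iso\<close>.\<close>

lemma Desc_structured:
  obtains S R where "Desc p K = structured_cat (fiber p (Dom B f)) S R"
    "bij_betw (\<lambda>(X, \<phi>). (X, cart p f\<^sub>2 X \<cdot> \<phi>)) S action_objects"
    "\<And>x y h. \<lbrakk>x \<in> S; y \<in> S; h \<in> Hom (fiber p (Dom B f)) (fst x) (fst y)\<rbrakk> \<Longrightarrow>
      R x y h \<longleftrightarrow> action_mor ((\<lambda>(X, \<phi>). (X, cart p f\<^sub>2 X \<cdot> \<phi>)) x) ((\<lambda>(X, \<phi>). (X, cart p f\<^sub>2 X \<cdot> \<phi>)) y) h"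
proof
  let ?C = "fiber p (Dom B f)" and ?D = "fiber p (Dom B f\<^sub>1)"
  let ?\<Phi> = "\<lambda>(X, \<phi>). (X, cart p f\<^sub>2 X \<cdot> \<phi>)"
  let ?S = "{(X, \<phi>). X \<in> Ob ?C \<and> \<phi> \<in> Hom ?D (pull_ob f\<^sub>1 X) (pull_ob f\<^sub>2 X) \<and> is_iso ?D \<phi>
    \<and> inv_trans p (d2 p K) X \<cdot> on_mor (pull p \<Delta>) \<phi> \<cdot> d1 p K X = Idm E X
    \<and> on_mor (pull p \<pi>\<^sub>1) \<phi> \<cdot> j12 p K X \<cdot> on_mor (pull p \<pi>\<^sub>2) \<phi>
        = j2 p K X \<cdot> on_mor (pull p \<pi>) \<phi> \<cdot> inv_trans p (j1 p K) X}"
  let ?R = "\<lambda>(X, \<phi>) (Y, \<psi>) \<theta>. on_mor (pull p f\<^sub>2) \<theta> \<cdot> \<phi> = \<psi> \<cdot> on_mor (pull p f\<^sub>1) \<theta>"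
  show "Desc p K = structured_cat ?C ?S ?R" by (simp add: Desc_def)
  have S: "(X, \<phi>) \<in> ?S \<longleftrightarrow> X \<in> Ob E \<and> P\<^sub>o X = Dom B f \<and> \<phi> \<in> Hom ?D (pull_ob f\<^sub>1 X) (pull_ob f\<^sub>2 X)
      \<and> lawful X (cart p f\<^sub>2 X \<cdot> \<phi>)" for X \<phi>
    using desc_laws[of X \<phi>] lawful_imp_iso[of X \<phi>] by (auto simp: Hom_fiber)
  show "bij_betw ?\<Phi> ?S action_objects"
  proof (rule bij_betw_imageI)
    show "inj_on ?\<Phi> ?S"
    proof (rule inj_onI)
      fix x y assume x: "x \<in> ?S" and y: "y \<in> ?S" and eq: "?\<Phi> x = ?\<Phi> y"
      obtain X a Y b where xy [simp]: "x = (X, a)" "y = (Y, b)" by (cases x; cases y)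
      have [simp]: "Y = X" using eq by simp
      have X: "X \<in> Ob E" "P\<^sub>o X = Dom B f" using x unfolding xy S by simp_all
      have "a = b"
        by (rule cart_cancel[of f\<^sub>2 X]) (use x y eq X in \<open>simp_all add: Hom_fiber\<close>)
      then show "x = y" by simp
    qed
    show "?\<Phi> ` ?S = action_objects"
    proof (intro equalityI subsetI)
      fix x assume "x \<in> ?\<Phi> ` ?S"
      then obtain y where y: "x = ?\<Phi> y" "y \<in> ?S" by (rule imageE)
      obtain X a where "y = (X, a)" by (cases y)
      with y have x: "x = (X, cart p f\<^sub>2 X \<cdot> a)" and a: "(X, a) \<in> ?S" by simp_all
      have "X \<in> Ob E" "P\<^sub>o X = Dom B f" "a \<in> Mor E" "Dom E a = pull_ob f\<^sub>1 X" "Cod E a = pull_ob f\<^sub>2 X"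
        "P a = Idm B (Dom B f\<^sub>1)" "lawful X (cart p f\<^sub>2 X \<cdot> a)"
        using a unfolding S by (simp_all add: Hom_fiber)
      then show "x \<in> action_objects" by (simp add: x action_objects_def premor_def)
    next
      fix x assume "x \<in> action_objects"
      then obtain X u where x: "x = (X, u)" and u: "premor X u" "lawful X u"
        by (auto simp: action_objects_def)
      note [simp] = premor_simps[OF u(1)]
      have "\<exists>!a. a \<in> Hom ?D (pull_ob f\<^sub>1 X) (pull_ob f\<^sub>2 X) \<and> cart p f\<^sub>2 X \<cdot> a = u"
        by (rule fiber_lift_ex1) simp_all
      then obtain a where a: "a \<in> Hom ?D (pull_ob f\<^sub>1 X) (pull_ob f\<^sub>2 X)" "cart p f\<^sub>2 X \<cdot> a = u" by blast
      then have "(X, a) \<in> ?S" using u unfolding S by simp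
      then show "x \<in> ?\<Phi> ` ?S" using a(2) x by force
    qed
  qed
  fix x y h assume x: "x \<in> ?S" and y: "y \<in> ?S" and h: "h \<in> Hom ?C (fst x) (fst y)"
  obtain X a Y b where xy [simp]: "x = (X, a)" "y = (Y, b)" by (cases x; cases y)
  have [simp]: "X \<in> Ob E" "P\<^sub>o X = Dom B f" "Y \<in> Ob E" "P\<^sub>o Y = Dom B f"
    "a \<in> Mor E" "Dom E a = pull_ob f\<^sub>1 X" "Cod E a = pull_ob f\<^sub>2 X" "P a = Idm B (Dom B f\<^sub>1)"
    "b \<in> Mor E" "Dom E b = pull_ob f\<^sub>1 Y" "Cod E b = pull_ob f\<^sub>2 Y" "P b = Idm B (Dom B f\<^sub>1)"
    "h \<in> Mor E" "Dom E h = X" "Cod E h = Y" "P h = Idm B (Dom B f)"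
    using x y h unfolding xy S by (simp_all add: Hom_fiber)
  let ?l = "on_mor (pull p f\<^sub>2) h \<cdot> a" and ?r = "b \<cdot> on_mor (pull p f\<^sub>1) h"
  have "?l = ?r \<longleftrightarrow> cart p f\<^sub>2 Y \<cdot> ?l = cart p f\<^sub>2 Y \<cdot> ?r"
    by (rule cartesian_cancel_iff[symmetric]) simp_all
  then show "?R x y h \<longleftrightarrow> action_mor (?\<Phi> x) (?\<Phi> y) h" by (simp add: action_mor_def)
qed

end

theorem theorem2:
  fixes p :: "('co, 'cm, 'eo, 'em) bifib"
    and f f\<^sub>1 f\<^sub>2 \<pi>\<^sub>1 \<pi>\<^sub>2 :: 'cm
  assumes "has_pullbacks (base p)"
    and "cloven_bifibration p"
    and "beck_chevalley p"
    and "f \<in> Mor (base p)"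
    and "pullback_square (base p) f\<^sub>1 f\<^sub>2 f f"
    and "pullback_square (base p) \<pi>\<^sub>2 \<pi>\<^sub>1 f\<^sub>1 f\<^sub>2"
  shows "equivalent_categories (EM p f) (Desc p (Eq (base p) f\<^sub>1 f\<^sub>2 \<pi>\<^sub>1 \<pi>\<^sub>2))
       \<and> equivalent_categories (Desc p (Eq (base p) f\<^sub>1 f\<^sub>2 \<pi>\<^sub>1 \<pi>\<^sub>2))
           (Act p (Eq (base p) f\<^sub>1 f\<^sub>2 \<pi>\<^sub>1 \<pi>\<^sub>2))"
proof -
  interpret cloven_bifibration p by (fact assms(2))
  interpret kernel_pair_bifibration p f f\<^sub>1 f\<^sub>2 \<pi>\<^sub>1 \<pi>\<^sub>2
    using assms(3,5,6) by unfold_locales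
  obtain S R where EM: "EM p f = structured_cat (fiber p (Dom B f)) S R"
    "bij_betw (\<lambda>(X, \<alpha>). (X, \<alpha> \<cdot> kernel_lift X)) S action_objects"
    "\<And>x y h. \<lbrakk>x \<in> S; y \<in> S; h \<in> Hom (fiber p (Dom B f)) (fst x) (fst y)\<rbrakk> \<Longrightarrow>
      R x y h \<longleftrightarrow> action_mor ((\<lambda>(X, \<alpha>). (X, \<alpha> \<cdot> kernel_lift X)) x) ((\<lambda>(X, \<alpha>). (X, \<alpha> \<cdot> kernel_lift X)) y) h"
    using EM_structured by blast
  obtain S' R' where Desc: "Desc p K = structured_cat (fiber p (Dom B f)) S' R'"
    "bij_betw (\<lambda>(X, \<phi>). (X, cart p f\<^sub>2 X \<cdot> \<phi>)) S' action_objects"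
    "\<And>x y h. \<lbrakk>x \<in> S'; y \<in> S'; h \<in> Hom (fiber p (Dom B f)) (fst x) (fst y)\<rbrakk> \<Longrightarrow>
      R' x y h \<longleftrightarrow> action_mor ((\<lambda>(X, \<phi>). (X, cart p f\<^sub>2 X \<cdot> \<phi>)) x) ((\<lambda>(X, \<phi>). (X, cart p f\<^sub>2 X \<cdot> \<phi>)) y) h"
    using Desc_structured by blast
  obtain S'' R'' where Act: "Act p K = structured_cat (fiber p (Dom B f)) S'' R''"
    "bij_betw (\<lambda>(X, \<beta>). (X, \<beta> \<cdot> cocart p f\<^sub>2 (pull_ob f\<^sub>1 X))) S'' action_objects"
    "\<And>x y h. \<lbrakk>x \<in> S''; y \<in> S''; h \<in> Hom (fiber p (Dom B f)) (fst x) (fst y)\<rbrakk> \<Longrightarrow>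
      R'' x y h \<longleftrightarrow> action_mor ((\<lambda>(X, \<beta>). (X, \<beta> \<cdot> cocart p f\<^sub>2 (pull_ob f\<^sub>1 X))) x)
        ((\<lambda>(X, \<beta>). (X, \<beta> \<cdot> cocart p f\<^sub>2 (pull_ob f\<^sub>1 X))) y) h"
    using Act_structured by blast
  \<comment> \<open>The premises skipped by underscores say that the bijections preserve underlying
    objects; \<open>split_beta\<close> reduces them to projections of pairs.\<close>
  show ?thesis
    unfolding K_def[symmetric] EM(1) Desc(1) Act(1)
    using equivalent_structured_cats_over[OF structured_action EM(2) _ EM(3) Desc(2) _ Desc(3)]
      equivalent_structured_cats_over[OF structured_action Desc(2) _ Desc(3) Act(2) _ Act(3)]
    by (simp add: split_beta)
qed

end
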